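(* Let $q\in L^1(\mathbb{R}_+)$ be complex-valued, let $Q=\begin{pmatrix}0&q\\ \overline{q}&0\end{pmatrix}$, and let $k\in\mathbb{C}\setminus\{0\}$. There exist four $\mathbb{C}^2$-valued solutions (called Jost solutions) $\mathbf{F}_{-1}(\cdot,k)$, $\mathbf{F}_{+1}(\cdot,k)$, $\mathbf{F}_{+\mathrm{i}}(\cdot,k)$, $\mathbf{F}_{-\mathrm{i}}(\cdot,k)$ of the differential equation $$-\epsilon F''+QF=k^2F \quad\text{on } \mathbb{R}_+$$ with the asymptotics $$\mathbf{F}_{\pm1}(x,k)=\mathrm{e}^{\pm kx}e_-+o(\mathrm{e}^{\pm kx}),\qquad \mathbf{F}_{\pm \mathrm{i}}(x,k)=\mathrm{e}^{\pm \mathrm{i} kx}e_++o(\mathrm{e}^{\pm \mathrm{i} kx}),\qquad x\to\infty,$$ and whose derivatives with respect to $x$ satisfy $$\mathbf{F}_{\pm 1}'(x,k)=\pm k\,\mathrm{e}^{\pm kx}e_-+o(\mathrm{e}^{\pm kx}),\qquad \mathbf{F}_{\pm \mathrm{i}}'(x,k)=\pm \mathrm{i} k\,\mathrm{e}^{\pm \mathrm{i} kx}e_++o(\mathrm{e}^{\pm \mathrm{i} kx}),\qquad x\to\infty.$$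
   Context: $\mathbb{R}_+=(0,\infty)$, $\epsilon=\begin{pmatrix}0&1\\1&0\end{pmatrix}$, $e_+=\begin{pmatrix}1\\1\end{pmatrix}$, $e_-=\begin{pmatrix}1\\-1\end{pmatrix}$. A solution of the differential equation is a function $F:[0,\infty)\to\mathbb{C}^2$ such that $F$ and $F'$ are locally absolutely continuous and the equation holds almost everywhere. The notation $o(\mathrm{e}^{ax})$ with complex $a$ means a $\mathbb{C}^2$-valued function whose Euclidean norm divided by $|\mathrm{e}^{ax}|$ tends to $0$ as $x\to\infty$. *)

theory Defs
  imports "HOL-Analysis.Analysis"
begin

definition absolutely_continuous_on :: "real set \<Rightarrow> (real \<Rightarrow> 'a::metric_space) \<Rightarrow> bool" where
  "absolutely_continuous_on S f \<longleftrightarrow>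
     (\<forall>\<epsilon>>0. \<exists>\<delta>>0. \<forall>(n::nat) (s::nat \<Rightarrow> real) (t::nat \<Rightarrow> real).
        (\<forall>i<n. s i \<in> S \<and> t i \<in> S \<and> s i \<le> t i) \<longrightarrow>
        disjoint_family_on (\<lambda>i. {s i<..<t i}) {..<n} \<longrightarrow>
        (\<Sum>i<n. t i - s i) < \<delta> \<longrightarrow>
        (\<Sum>i<n. dist (f (s i)) (f (t i))) < \<epsilon>)"

definition locally_absolutely_continuous_on :: "real set \<Rightarrow> (real \<Rightarrow> 'a::metric_space) \<Rightarrow> bool" where
  "locally_absolutely_continuous_on S f \<longleftrightarrow>
     (\<forall>a b. {a..b} \<subseteq> S \<longrightarrow> absolutely_continuous_on {a..b} f)"

text \<open>The derivative on the half line \<open>[0,\<infinity>)\<close>, one-sided at \<open>0\<close>.\<close>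

definition half_line_deriv :: "(real \<Rightarrow> complex ^ 2) \<Rightarrow> real \<Rightarrow> complex ^ 2" where
  "half_line_deriv F x = vector_derivative F (at x within {0..})"

definition eps_mat :: "complex ^ 2 ^ 2" where
  "eps_mat = vector [vector [0, 1], vector [1, 0]]"

definition e_plus :: "complex ^ 2" where
  "e_plus = vector [1, 1]"

definition e_minus :: "complex ^ 2" where
  "e_minus = vector [1, -1]"

definition Q_mat :: "(real \<Rightarrow> complex) \<Rightarrow> real \<Rightarrow> complex ^ 2 ^ 2" where
  "Q_mat q x = vector [vector [0, q x], vector [cnj (q x), 0]]"

text \<open>
  Since \<^const>\<open>vector_derivative\<close> has an unspecified value where no derivative exists,
  differentiability is demanded explicitly: everywhere for \<open>F\<close>, and almost everywhere for \<open>F'\<close>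
  (where it already follows from local absolute continuity).
\<close>

definition is_solution :: "(real \<Rightarrow> complex) \<Rightarrow> complex \<Rightarrow> (real \<Rightarrow> complex ^ 2) \<Rightarrow> bool" where
  "is_solution q k F \<longleftrightarrow>
     locally_absolutely_continuous_on {0..} F \<and>
     (\<forall>x\<ge>0. F differentiable (at x within {0..})) \<and>
     locally_absolutely_continuous_on {0..} (half_line_deriv F) \<and>
     (AE x in lebesgue_on {0<..}.
        half_line_deriv F differentiable (at x within {0..}) \<and>
        - (eps_mat *v half_line_deriv (half_line_deriv F) x) + Q_mat q x *v F x = k\<^sup>2 *s F x)"

text \<open>\<open>R(x) = o(e\<^sup>a\<^sup>x)\<close> as \<open>x \<rightarrow> \<infinity>\<close>, for complex \<open>a\<close>; the norm on \<^typ>\<open>complex ^ 2\<close> is the Euclidean one.\<close>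

definition small_o_exp :: "complex \<Rightarrow> (real \<Rightarrow> complex ^ 2) \<Rightarrow> bool" where
  "small_o_exp a R \<longleftrightarrow>
     ((\<lambda>x. norm (R x) / cmod (exp (a * of_real x))) \<longlongrightarrow> 0) at_top"

end

theory Submission
  imports Defs
begin

text \<open>
  Write \<open>F = u e\<^sub>+ + v e\<^sub>-\<close>. As \<open>\<epsilon>\<close> is diagonal in the basis \<open>e\<^sub>+, e\<^sub>-\<close> and \<open>\<epsilon>\<^sup>2 = 1\<close>, the equation decouples up
  to the integrable potential: \<open>u'' = (\<i>k)\<^sup>2 u + g\<^sub>+\<close> and \<open>v'' = k\<^sup>2 v + g\<^sub>-\<close>, where \<open>g\<^sub>+\<close> and \<open>g\<^sub>-\<close> are linear
  in \<open>F\<close> with coefficients \<open>q\<close> and its conjugate. Given the exponent \<open>\<mu>\<close> of the wanted solution,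
  put \<open>F = e\<^sup>\<mu>\<^sup>x z\<close> and use variation of constants for each exponent \<open>\<lambda> = \<plusminus>k, \<plusminus>\<i>k\<close>, integrating from a
  fixed \<open>a\<close> if \<open>Re (\<lambda> - \<mu>) < 0\<close> and from infinity otherwise. The kernels are then bounded by \<open>1\<close> beyond \<open>a\<close>,
  where the \<open>L\<^sup>1\<close> norm of \<open>q\<close> is small; on \<open>[0,a]\<close> they are possibly large, but of Volterra type, so an
  exponential weight makes the whole map a contraction on \<open>[0,\<infinity>)\<close>. By dominated convergence the
  integral terms of the fixed point vanish at infinity.
\<close>

section \<open>Lebesgue differentiation on the line\<close>

text \<open>If \<mu> has the least real part among the four exponents, integrating from infinity is
  possible for every \<lambda>. For any other \<mu> it fails: when Re (\<lambda> - \<mu>) < 0, the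
  kernel \<open>exp ((\<lambda> - \<mu>) * (x - t))\<close> is unbounded for t > x. The finite lower
  limit forced by this makes the equation one of mixed type beyond \<open>a\<close>, where iterates
  gain no factorial decay, so smallness of the tail of q has to supply the contraction. Solving on
  the whole half line at once replaces a separate continuation from \<open>a\<close> back to 0.
  Since q is only integrable, F' is continuous but differentiable merely almost everywhere. Its
  absolute continuity is obtained from integral bounds on increments, and the equation itself from
  Lebesgue differentiation of the integrals in the formula for F'. The asymptotics of F' need no
  differentiation of those of F: for each of u and v, the derivative consists of the same two
  integral terms, with half their sum in place of their difference over 2 \<lambda>.\<close>

lemma negligible_outer_mod_null:
  fixes S :: "'a::euclidean_space set"
  assumes "\<And>e. e > 0 \<Longrightarrow> \<exists>N T. negligible N \<and> T \<in> lmeasurable \<and> measure lebesgue T \<le> e \<and> S \<subseteq> N \<union> T"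
  shows "negligible S"
  unfolding negligible_outer_le
proof (intro allI impI)
  fix e :: real assume "e > 0"
  then obtain N T where N: "negligible N" "T \<in> lmeasurable" "measure lebesgue T \<le> e" "S \<subseteq> N \<union> T"
    using assms by blast
  have "measure lebesgue (T \<union> N) = measure lebesgue T"
    using N by (intro measure_Un_null_set) (auto simp: negligible_iff_null_sets)
  with N show "\<exists>T. S \<subseteq> T \<and> T \<in> lmeasurable \<and> measure lebesgue T \<le> e"
    by (intro exI[of _ "T \<union> N"]) (auto simp: negligible_imp_measurable fmeasurable.Un negligible_iff_measure)
qed

text \<open>The intervals on which the quotient is bad form a Vitali cover of the set, and Henstock's lemma
  bounds the total length of disjoint tagged intervals among them.\<close>

lemma negligible_bad_quotient_points:
  fixes f :: "real \<Rightarrow> 'b::euclidean_space"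
  assumes f: "f integrable_on {a..b}" and eta: "\<eta> > 0"
  shows "negligible {x. \<forall>\<delta>>0. \<exists>c d. c \<le> x \<and> x \<le> d \<and> c < d \<and> {c..d} \<subseteq> {a..b} \<and> d - c < \<delta> \<and>
            norm ((d - c) *\<^sub>R f x - integral {c..d} f) \<ge> \<eta> * (d - c)}" (is "negligible ?S")
proof (rule negligible_outer_mod_null)
  fix e :: real assume e: "e > 0"
  have f': "f integrable_on cbox a b" using f by simp
  \<comment> \<open>The tolerance is \<open>\<eta> * e\<close> because each bad interval contributes
    at least \<eta> times its length; dividing by \<eta> leaves total length at most
    \<open>e\<close>.\<close>
  obtain \<gamma> where \<gamma>: "gauge \<gamma>" and fine:
     "\<And>p. \<lbrakk>p tagged_partial_division_of (cbox a b); \<gamma> fine p\<rbrakk> \<Longrightarrow>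
             sum (\<lambda>(x,K). norm(measure lborel K *\<^sub>R f x - integral K f)) p < \<eta> * e"
    using Henstock_lemma[OF f' mult_pos_pos[OF eta e]] by blast
  define K where "K = {(x,c,d). c \<le> x \<and> x \<le> d \<and> c < d \<and> {c..d} \<subseteq> {a..b} \<and> {c..d} \<subseteq> \<gamma> x \<and>
            norm ((d - c) *\<^sub>R f x - integral {c..d} f) \<ge> \<eta> * (d - c)}"
  \<comment> \<open>Midpoint and radius recast the intervals as balls, the form in which the Vitali
    theorem takes its cover. The tag x is kept in the index.\<close>
  define A where "A = (\<lambda>(x::real,c::real,d::real). (c + d) / 2)"
  define r where "r = (\<lambda>(x::real,c::real,d::real). (d - c) / 2)"
  have cb: "cball (A (x,c,d)) (r (x,c,d)) = {c..d}" for x c d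
    by (auto simp: A_def r_def cball_eq_atLeastAtMost field_simps)
  have rpos: "0 < r i" if "i \<in> K" for i
    using that by (auto simp: K_def r_def)
  have cover: "\<exists>i. i \<in> K \<and> x \<in> cball (A i) (r i) \<and> r i < d" if x: "x \<in> ?S" and d: "0 < d" for x d
  proof -
    obtain \<rho> where \<rho>: "\<rho> > 0" "ball x \<rho> \<subseteq> \<gamma> x"
      using \<gamma> by (meson gauge_def open_contains_ball)
    then obtain u v where uv: "u \<le> x" "x \<le> v" "u < v" "{u..v} \<subseteq> {a..b}" "v - u < min \<rho> d"
        "norm ((v - u) *\<^sub>R f x - integral {u..v} f) \<ge> \<eta> * (v - u)"
      using x d by (auto dest!: spec[of _ "min \<rho> d"])
    have "{u..v} \<subseteq> ball x \<rho>" using uv by (auto simp: dist_real_def)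
    then have "(x,u,v) \<in> K" using uv \<rho> by (auto simp: K_def)
    moreover have "r (x,u,v) < d" using uv by (auto simp: r_def)
    ultimately show ?thesis using uv cb by (intro exI[of _ "(x,u,v)"]) auto
  qed
  obtain C where C: "countable C" "C \<subseteq> K"
     "pairwise (\<lambda>i j. disjnt (cball (A i) (r i)) (cball (A j) (r j))) C"
     "negligible (?S - (\<Union>i \<in> C. cball (A i) (r i)))"
    using Vitali_covering_theorem_cballs[of K r ?S A, OF rpos cover] by blast
  \<comment> \<open>Henstock's lemma speaks of finite partial divisions. The bound does not depend
    on \<open>I'\<close>, so it passes to the countable family \<open>C\<close>.\<close>
  have bound: "measure lebesgue (\<Union>i\<in>I'. cball (A i) (r i)) \<le> e" if I': "I' \<subseteq> C" "finite I'" for I'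
  proof -
    define p where "p = (\<lambda>i. (fst i, cball (A i) (r i))) ` I'"
    have inK: "i \<in> K" if "i \<in> I'" for i using that I' C by blast
    have disj: "disjnt (cball (A i) (r i)) (cball (A j) (r j))" if "i \<in> I'" "j \<in> I'" "i \<noteq> j" for i j
      using that C(3) I' unfolding pairwise_def by blast
    have inj: "inj_on (\<lambda>i. (fst i, cball (A i) (r i))) I'"
    proof (rule inj_onI, rule ccontr)
      fix i j assume ij: "i \<in> I'" "j \<in> I'" "(fst i, cball (A i) (r i)) = (fst j, cball (A j) (r j))" "i \<noteq> j"
      have "cball (A j) (r j) = cball (A i) (r i)" using ij(3) by simp
      then have "disjnt (cball (A i) (r i)) (cball (A i) (r i))" using disj[OF ij(1,2,4)] by simp
      moreover have "A i \<in> cball (A i) (r i)" using rpos[OF inK[OF ij(1)]] by simp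
      ultimately show False by (auto simp: disjnt_def)
    qed
    have "p tagged_partial_division_of (cbox a b)"
      unfolding tagged_partial_division_of_def
    proof (intro conjI allI impI; (elim conjE)?)
      show "finite p" using I' by (simp add: p_def)
      fix x k assume "(x,k) \<in> p"
      then obtain u v where "(x,u,v) \<in> I'" "k = {u..v}"
        by (auto simp: p_def cb)
      moreover from this have "(x,u,v) \<in> K" using inK by blast
      ultimately show "x \<in> k" "k \<subseteq> cbox a b" "\<exists>a b. k = cbox a b"
        by (simp_all add: K_def)
    next
      fix x1 k1 x2 k2 assume "(x1,k1) \<in> p" "(x2,k2) \<in> p" "(x1,k1) \<noteq> (x2,k2)"
      then obtain i j where "i \<in> I'" "j \<in> I'" "(x1,k1) = (fst i, cball (A i) (r i))" "(x2,k2) = (fst j, cball (A j) (r j))"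
        unfolding p_def by (elim imageE)
      with \<open>(x1,k1) \<noteq> (x2,k2)\<close> have "i \<in> I'" "j \<in> I'" "i \<noteq> j" "k1 = cball (A i) (r i)" "k2 = cball (A j) (r j)"
        by auto
      then show "interior k1 \<inter> interior k2 = {}"
        using disj interior_subset unfolding disjnt_def by (metis Int_mono bot.extremum_uniqueI)
    qed
    moreover have "\<gamma> fine p"
    proof -
      have "cball (A i) (r i) \<subseteq> \<gamma> (fst i)" if "i \<in> I'" for i
        using inK[OF that] cb by (auto simp: K_def)
      then show ?thesis unfolding fine_def p_def by auto
    qed
    ultimately have "sum (\<lambda>(x,K). norm(measure lborel K *\<^sub>R f x - integral K f)) p < \<eta> * e"
      by (rule fine)
    also have "sum (\<lambda>(x,K). norm(measure lborel K *\<^sub>R f x - integral K f)) p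
       = (\<Sum>i\<in>I'. norm(measure lborel (cball (A i) (r i)) *\<^sub>R f (fst i) - integral (cball (A i) (r i)) f))"
      unfolding p_def by (subst sum.reindex[OF inj]) (simp add: o_def)
    finally have 1: "(\<Sum>i\<in>I'. norm(measure lborel (cball (A i) (r i)) *\<^sub>R f (fst i) - integral (cball (A i) (r i)) f)) < \<eta> * e" .
    have "\<eta> * (\<Sum>i\<in>I'. measure lebesgue (cball (A i) (r i)))
       = (\<Sum>i\<in>I'. \<eta> * measure lebesgue (cball (A i) (r i)))" by (simp add: sum_distrib_left)
    also have "\<dots> \<le> (\<Sum>i\<in>I'. norm(measure lborel (cball (A i) (r i)) *\<^sub>R f (fst i) - integral (cball (A i) (r i)) f))"
    proof (rule sum_mono)
      fix i assume "i \<in> I'"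
      then obtain x u v where i: "i = (x,u,v)" "(x,u,v) \<in> K" using inK by (metis prod_cases3)
      then show "\<eta> * measure lebesgue (cball (A i) (r i)) \<le> norm(measure lborel (cball (A i) (r i)) *\<^sub>R f (fst i) - integral (cball (A i) (r i)) f)"
        by (auto simp: cb K_def)
    qed
    finally have "\<eta> * (\<Sum>i\<in>I'. measure lebesgue (cball (A i) (r i))) \<le> \<eta> * e" using 1 by linarith
    then have "(\<Sum>i\<in>I'. measure lebesgue (cball (A i) (r i))) \<le> e" using eta by simp
    moreover have "measure lebesgue (\<Union>i\<in>I'. cball (A i) (r i)) \<le> (\<Sum>i\<in>I'. measure lebesgue (cball (A i) (r i)))"
      by (rule measure_UNION_le) (use I' in auto)
    ultimately show ?thesis by linarith
  qed
  have T: "(\<Union>i\<in>C. cball (A i) (r i)) \<in> lmeasurable"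
    by (rule fmeasurable_UN_bound[OF C(1) _ bound]) auto
  have T2: "measure lebesgue (\<Union>i\<in>C. cball (A i) (r i)) \<le> e"
    by (rule measure_UN_bound[OF C(1) _ bound]) auto
  show "\<exists>N T. negligible N \<and> T \<in> lmeasurable \<and> measure lebesgue T \<le> e \<and> ?S \<subseteq> N \<union> T"
    using C(4) T T2 by blast
qed

text \<open>Outside the countable union of the bad sets for the thresholds 1/(n+1), the mean of f
  over every sufficiently short interval containing x is as close to f x as desired. Intervals with
  x as an end point give the difference quotients from both sides.\<close>

lemma lebesgue_differentiation_interval:
  fixes f :: "real \<Rightarrow> 'b::euclidean_space"
  assumes f: "f integrable_on {a..b}"
  shows "negligible {x \<in> {a<..<b}. \<not> ((\<lambda>u. integral {a..u} f) has_vector_derivative f x) (at x)}"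
proof -
  define S where "S n = {x. \<forall>\<delta>>0. \<exists>c d. c \<le> x \<and> x \<le> d \<and> c < d \<and> {c..d} \<subseteq> {a..b} \<and> d - c < \<delta> \<and>
            norm ((d - c) *\<^sub>R f x - integral {c..d} f) \<ge> inverse (real (Suc n)) * (d - c)}" for n
  have "negligible (\<Union>n. S n)"
    unfolding S_def by (intro negligible_Union_nat negligible_bad_quotient_points[OF f]) simp
  moreover have "((\<lambda>u. integral {a..u} f) has_vector_derivative f x) (at x)"
    if x: "x \<in> {a<..<b}" "x \<notin> (\<Union>n. S n)" for x
    unfolding has_vector_derivative_def has_derivative_at_alt
  proof (intro conjI allI impI bounded_linear_scaleR_left)
    fix e :: real assume e: "e > 0"
    then obtain n where n: "inverse (real (Suc n)) < e" using reals_Archimedean by blast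
    have "x \<notin> S n" using x by blast
    then obtain \<delta> where \<delta>: "\<delta> > 0" and none: "\<not> (\<exists>c d. c \<le> x \<and> x \<le> d \<and> c < d \<and> {c..d} \<subseteq> {a..b} \<and> d - c < \<delta> \<and>
            norm ((d - c) *\<^sub>R f x - integral {c..d} f) \<ge> inverse (real (Suc n)) * (d - c))"
      unfolding S_def mem_Collect_eq not_all not_imp by (elim exE conjE)
    have small: "norm ((d - c) *\<^sub>R f x - integral {c..d} f) < inverse (real (Suc n)) * (d - c)"
      if "c \<le> x" "x \<le> d" "c < d" "{c..d} \<subseteq> {a..b}" "d - c < \<delta>" for c d
      using none that unfolding not_le[symmetric] by blast
    define \<rho> where "\<rho> = min \<delta> (min (x - a) (b - x))"
    have "\<rho> > 0" using \<delta> x by (auto simp: \<rho>_def)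
    moreover have "norm (integral {a..y} f - integral {a..x} f - (y - x) *\<^sub>R f x) \<le> e * norm (y - x)"
      if y: "norm (y - x) < \<rho>" for y
    proof -
      have ay: "a \<le> y" "y \<le> b" using y x by (auto simp: \<rho>_def)
      have sub: "f integrable_on {a..u}" if "u \<le> b" for u
        using f by (rule integrable_subinterval_real) (use that in auto)
      consider "x < y" | "x = y" | "y < x" by linarith
      then show ?thesis
      proof cases
        case 1
        have "integral {a..x} f + integral {x..y} f = integral {a..y} f"
          by (rule Henstock_Kurzweil_Integration.integral_combine) (use 1 x ay sub in auto)
        then have "norm (integral {a..y} f - integral {a..x} f - (y - x) *\<^sub>R f x)
            = norm ((y - x) *\<^sub>R f x - integral {x..y} f)"
          by (metis add_diff_cancel_left' norm_minus_commute)
        also have "\<dots> \<le> inverse (real (Suc n)) * (y - x)"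
          using 1 x ay y by (intro less_imp_le[OF small]) (auto simp: \<rho>_def)
        also have "\<dots> \<le> e * (y - x)" using n 1 by (intro mult_right_mono) auto
        finally show ?thesis using 1 by simp
      next
        case 3
        have "integral {a..y} f + integral {y..x} f = integral {a..x} f"
          by (rule Henstock_Kurzweil_Integration.integral_combine) (use 3 x ay sub in auto)
        then have "integral {a..y} f - integral {a..x} f - (y - x) *\<^sub>R f x = (x - y) *\<^sub>R f x - integral {y..x} f"
          by (simp add: algebra_simps)
        then have "norm (integral {a..y} f - integral {a..x} f - (y - x) *\<^sub>R f x)
            = norm ((x - y) *\<^sub>R f x - integral {y..x} f)" by simp
        also have "\<dots> \<le> inverse (real (Suc n)) * (x - y)"
          using 3 x ay y by (intro less_imp_le[OF small]) (auto simp: \<rho>_def)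
        also have "\<dots> \<le> e * (x - y)" using n 3 by (intro mult_right_mono) auto
        finally show ?thesis using 3 by simp
      qed simp
    qed
    ultimately show "\<exists>d>0. \<forall>y. norm (y - x) < d \<longrightarrow> norm (integral {a..y} f - integral {a..x} f - (y - x) *\<^sub>R f x) \<le> e * norm (y - x)"
      by blast
  qed
  ultimately show ?thesis
    by (elim negligible_subset) auto
qed

section \<open>Absolute continuity of primitives\<close>

text \<open>Each point lies in at most one of the open intervals, so the restrictions of f to them
  add up to at most f; end points do not affect the integrals.\<close>

lemma sum_integral_disjoint_le:
  fixes f :: "real \<Rightarrow> real" and n :: nat
  assumes f: "f integrable_on {a..b}" and f0: "\<And>x. x \<in> {a..b} \<Longrightarrow> 0 \<le> f x"
    and st: "\<And>i. i < n \<Longrightarrow> a \<le> s i \<and> s i \<le> t i \<and> t i \<le> b"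
    and disj: "disjoint_family_on (\<lambda>i. {s i<..<t i}) {..<n}"
  shows "(\<Sum>i<n. integral {s i..t i} f) \<le> integral {a..b} f"
proof -
  have int: "(\<lambda>x. if x \<in> {s i<..<t i} then f x else 0) integrable_on {a..b}"
    and val: "integral {s i..t i} f = integral {a..b} (\<lambda>x. if x \<in> {s i<..<t i} then f x else 0)"
    if "i < n" for i
  proof -
    have eq: "{s i<..<t i} \<inter> {a..b} = {s i<..<t i}" using st[OF that] by auto
    have "f integrable_on {s i..t i}"
      by (rule integrable_subinterval_real[OF f]) (use st[OF that] in auto)
    then have "f integrable_on {s i<..<t i}" by (simp add: integrable_on_open_interval_real)
    then show "(\<lambda>x. if x \<in> {s i<..<t i} then f x else 0) integrable_on {a..b}"
      unfolding integrable_restrict_Int eq .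
    show "integral {s i..t i} f = integral {a..b} (\<lambda>x. if x \<in> {s i<..<t i} then f x else 0)"
      unfolding integral_restrict_Int eq by (simp add: integral_open_interval_real)
  qed
  have "(\<Sum>i<n. integral {s i..t i} f) = integral {a..b} (\<lambda>x. \<Sum>i<n. if x \<in> {s i<..<t i} then f x else 0)"
    by (subst integral_sum) (use val int in simp_all)
  also have "\<dots> \<le> integral {a..b} f"
  proof (rule integral_le)
    fix x assume x: "x \<in> {a..b}"
    show "(\<Sum>i<n. if x \<in> {s i<..<t i} then f x else 0) \<le> f x"
    proof (cases "\<exists>j<n. x \<in> {s j<..<t j}")
      case True
      then obtain j where j: "j < n" "x \<in> {s j<..<t j}" by blast
      have "x \<in> {s i<..<t i} \<longleftrightarrow> i = j" if "i < n" for i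
        using disjoint_family_onD[OF disj, of i j] that j by blast
      then have "(\<Sum>i<n. if x \<in> {s i<..<t i} then f x else 0) = (\<Sum>i<n. if i = j then f x else 0)"
        by (intro sum.cong) simp_all
      then show ?thesis using j by simp
    next
      case False
      then have "(\<Sum>i<n. if x \<in> {s i<..<t i} then f x else 0) = 0" by (intro sum.neutral) auto
      then show ?thesis using f0[OF x] by simp
    qed
  qed (use int in \<open>auto intro!: integrable_sum f simp del: greaterThanLessThan_iff\<close>)
  finally show ?thesis .
qed

text \<open>The excess of f over level N vanishes pointwise as soon as N reaches f x and is
  dominated by f. Cutting there splits f into a bounded part and a part of small integral.\<close>

lemma truncation_integral_small:
  fixes f :: "real \<Rightarrow> real"
  assumes f: "f integrable_on {a..b}" and f0: "\<And>x. x \<in> {a..b} \<Longrightarrow> 0 \<le> f x" and e: "e > 0"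
  obtains N :: nat where "(\<lambda>x. min (f x) (real N)) integrable_on {a..b}"
    "integral {a..b} (\<lambda>x. f x - min (f x) (real N)) < e"
proof -
  have fa: "f absolutely_integrable_on {a..b}"
    using f f0 by (intro nonnegative_absolutely_integrable_1) auto
  have mi: "(\<lambda>x. min (f x) (real N)) integrable_on {a..b}" for N
    by (rule set_lebesgue_integral_eq_integral(1), rule absolutely_integrable_min_1[OF fa]) auto
  have lim: "(\<lambda>N. integral {a..b} (\<lambda>x. f x - min (f x) (real N))) \<longlonglongrightarrow> integral {a..b} (\<lambda>x. 0)"
  proof (rule dominated_convergence(2)[where h = f])
    fix x assume "x \<in> {a..b}"
    have "eventually (\<lambda>N. f x - min (f x) (real N) = 0) sequentially"
      using eventually_ge_at_top[of "nat \<lceil>f x\<rceil>"] by eventually_elim linarith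
    then show "(\<lambda>N. f x - min (f x) (real N)) \<longlonglongrightarrow> 0" by (rule tendsto_eventually)
  qed (use f f0 mi in \<open>auto intro!: integrable_diff simp: min_def\<close>)
  then have "eventually (\<lambda>N. integral {a..b} (\<lambda>x. f x - min (f x) (real N)) < e) sequentially"
    using e by (intro order_tendstoD) auto
  then show ?thesis using that mi by (auto simp: eventually_sequentially)
qed

text \<open>The unbounded part of f costs at most e/2 in total by truncation, the rest at most N
  times the total length. The choice e / (2 (N + 1)) for the length bound stays meaningful when N =
  0.\<close>

lemma absolutely_continuous_onI_integral:
  fixes F :: "real \<Rightarrow> 'a::metric_space" and f :: "real \<Rightarrow> real"
  assumes f: "f integrable_on {a..b}" and f0: "\<And>x. x \<in> {a..b} \<Longrightarrow> 0 \<le> f x"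
    and F: "\<And>s t. a \<le> s \<Longrightarrow> s \<le> t \<Longrightarrow> t \<le> b \<Longrightarrow> dist (F s) (F t) \<le> integral {s..t} f"
  shows "absolutely_continuous_on {a..b} F"
  unfolding absolutely_continuous_on_def
proof (intro allI impI)
  fix e :: real assume e: "e > 0"
  obtain N where N: "(\<lambda>x. min (f x) (real N)) integrable_on {a..b}"
    "integral {a..b} (\<lambda>x. f x - min (f x) (real N)) < e / 2"
    using truncation_integral_small[OF f f0, of "e/2"] e by auto
  have "(\<Sum>i<n. dist (F (s i)) (F (t i))) < e"
    if st: "\<forall>i<n. s i \<in> {a..b} \<and> t i \<in> {a..b} \<and> s i \<le> t i"
    and disj: "disjoint_family_on (\<lambda>i. {s i<..<t i}) {..<n}"
    and small: "(\<Sum>i<n. t i - s i) < e / (2 * (real N + 1))" for n :: nat and s t :: "nat \<Rightarrow> real"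
  proof -
    have mono: "dist (F (s i)) (F (t i)) \<le> integral {s i..t i} (\<lambda>x. f x - min (f x) (real N)) + real N * (t i - s i)"
      if i: "i < n" for i
    proof -
      have sub: "g integrable_on {s i..t i}" if "g integrable_on {a..b}" for g :: "real \<Rightarrow> real"
        by (rule integrable_subinterval_real[OF that]) (use st i in auto)
      have "dist (F (s i)) (F (t i)) \<le> integral {s i..t i} f" using F st i by auto
      also have "\<dots> = integral {s i..t i} (\<lambda>x. f x - min (f x) (real N)) + integral {s i..t i} (\<lambda>x. min (f x) (real N))"
        by (subst integral_diff) (auto intro: sub f N)
      also have "integral {s i..t i} (\<lambda>x. min (f x) (real N)) \<le> integral {s i..t i} (\<lambda>x. real N)"
        by (rule integral_le) (auto intro: sub N)
      finally show ?thesis using st i by (simp add: mult.commute)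
    qed
    have "(\<Sum>i<n. dist (F (s i)) (F (t i)))
        \<le> (\<Sum>i<n. integral {s i..t i} (\<lambda>x. f x - min (f x) (real N)) + real N * (t i - s i))"
      by (rule sum_mono) (use mono in auto)
    also have "\<dots> = (\<Sum>i<n. integral {s i..t i} (\<lambda>x. f x - min (f x) (real N))) + real N * (\<Sum>i<n. t i - s i)"
      by (simp add: sum.distrib sum_distrib_left)
    also have "(\<Sum>i<n. integral {s i..t i} (\<lambda>x. f x - min (f x) (real N))) \<le> integral {a..b} (\<lambda>x. f x - min (f x) (real N))"
      by (rule sum_integral_disjoint_le[OF _ _ _ disj]) (use st f N in \<open>auto intro!: integrable_diff\<close>)
    also have "real N * (\<Sum>i<n. t i - s i) \<le> (real N + 1) * (e / (2 * (real N + 1)))"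
      using small st by (intro mult_mono) (auto intro!: sum_nonneg)
    also have "\<dots> = e / 2" by (simp add: field_simps)
    finally show ?thesis using N by simp
  qed
  moreover have "e / (2 * (real N + 1)) > 0" using e by simp
  ultimately show "\<exists>\<delta>>0. \<forall>(n::nat) s t. (\<forall>i<n. s i \<in> {a..b} \<and> t i \<in> {a..b} \<and> s i \<le> t i) \<longrightarrow>
        disjoint_family_on (\<lambda>i. {s i<..<t i}) {..<n} \<longrightarrow>
        (\<Sum>i<n. t i - s i) < \<delta> \<longrightarrow> (\<Sum>i<n. dist (F (s i)) (F (t i))) < e"
    by blast
qed

text \<open>\<open>locally_absolutely_continuous_on\<close> ranges over all pairs a, b, so intervals
  with b < a arise. Without points to choose from, n must be 0 and the sum is empty.\<close>

lemma absolutely_continuous_on_empty: "absolutely_continuous_on {} F"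
  unfolding absolutely_continuous_on_def
proof (intro allI impI)
  fix e :: real assume "e > 0"
  then have "(\<Sum>i<n. dist (F (s i)) (F (t i))) < e"
    if "\<forall>i<n. s i \<in> {} \<and> t i \<in> {} \<and> s i \<le> t i" for n :: nat and s t
    using that by (cases n) auto
  then show "\<exists>\<delta>>0. \<forall>(n::nat) s t. (\<forall>i<n. s i \<in> {} \<and> t i \<in> {} \<and> s i \<le> t i) \<longrightarrow>
        disjoint_family_on (\<lambda>i. {s i<..<t i}) {..<n} \<longrightarrow>
        (\<Sum>i<n. t i - s i) < \<delta> \<longrightarrow> (\<Sum>i<n. dist (F (s i)) (F (t i))) < e"
    by (intro exI[of _ 1]) auto
qed

section \<open>The weight\<close>

text \<open>A bridge from the Bochner integral, used for the operators, to the gauge integral, used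
  for primitives. The half-open interval matches the kernels, which distinguish
  \<open>t \<le> x\<close> from \<open>x < t\<close>; its missing end point is a null set.\<close>

lemma integral_Ioc_eq_integral:
  fixes f :: "real \<Rightarrow> 'a::euclidean_space"
  assumes "integrable lebesgue (\<lambda>t. indicator {x<..y} t *\<^sub>R f t)"
  shows "f absolutely_integrable_on {x..y}"
    and "(LINT t|lebesgue. indicator {x<..y} t *\<^sub>R f t) = integral {x..y} f"
proof -
  have 1: "f absolutely_integrable_on {x<..y}"
    using assms by (simp add: set_integrable_def)
  then show 2: "f absolutely_integrable_on {x..y}"
    by (rule absolutely_integrable_spike_set; intro negligible_subset[OF negligible_sing[of x]]) auto
  have "(LINT t|lebesgue. indicator {x<..y} t *\<^sub>R f t) = integral {x<..y} f"
    using set_lebesgue_integral_eq_integral(2)[OF 1] by (simp add: set_lebesgue_integral_def)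
  also have "\<dots> = integral {x..y} f"
    by (rule integral_spike_set; intro negligible_subset[OF negligible_sing[of x]]) auto
  finally show "(LINT t|lebesgue. indicator {x<..y} t *\<^sub>R f t) = integral {x..y} f" .
qed

lemma tail_integral_tendsto_0:
  fixes r :: "real \<Rightarrow> real"
  assumes r: "integrable lebesgue r"
  shows "((\<lambda>a. LINT t|lebesgue. indicator {a<..} t * r t) \<longlongrightarrow> 0) at_top"
proof -
  have "((\<lambda>a. LINT t|lebesgue. indicator {a<..} t * r t) \<longlongrightarrow> (LINT t|(lebesgue::real measure). 0)) at_top"
  proof (rule integral_dominated_convergence_at_top[where w = "\<lambda>t. norm (r t)"])
    show "AE t in lebesgue. ((\<lambda>a. indicator {a<..} t * r t) \<longlongrightarrow> 0) at_top"
    proof (rule AE_I2)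
      fix t :: real
      have "eventually (\<lambda>a. indicator {a<..} t * r t = 0) at_top"
        using eventually_ge_at_top[of t] by eventually_elim auto
      then show "((\<lambda>a. indicator {a<..} t * r t) \<longlongrightarrow> 0) at_top" by (rule tendsto_eventually)
    qed
    show "(\<lambda>t. indicator {a<..} t * r t) \<in> borel_measurable lebesgue" for a
      using r by (intro borel_measurable_times borel_measurable_indicator) auto
  qed (use r in \<open>auto simp: indicator_def\<close>)
  then show ?thesis by simp
qed

text \<open>A common majorant for the kernels of all exponents, so that one weight serves every
  integral term. For \<open>t \<le> a\<close> it keeps the Volterra support \<open>x < t\<close>,
  which the weight exploits; for \<open>a < t\<close> only the size 1 matters.\<close>

definition kernel_bound :: "real \<Rightarrow> real \<Rightarrow> real \<Rightarrow> real \<Rightarrow> real" where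
  "kernel_bound a M x t = (if a < t then 1 else if x < t then M else 0)"

lemma kernel_bound_nonneg: "M \<ge> 0 \<Longrightarrow> kernel_bound a M x t \<ge> 0"
  by (simp add: kernel_bound_def)

lemma kernel_bound_le: "M \<ge> 1 \<Longrightarrow> kernel_bound a M x t \<le> M"
  by (simp add: kernel_bound_def)

lemma kernel_bound_measurable [measurable]: "kernel_bound a M x \<in> borel_measurable borel"
  unfolding kernel_bound_def by measurable

text \<open>Formally w' = - C r w, which would give equality with constant 1. The factor 2 is slack
  that avoids differentiating w: on short intervals w varies by a factor of at most 2, and
  \<open>exp y \<ge> 1 + y\<close> gives the inequality there. It is additive over adjacent
  intervals, so bisection (\<open>Bolzano\<close>) extends it to the whole interval.\<close>

lemma integral_exp_weight_le:
  fixes r :: "real \<Rightarrow> real"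
  assumes r: "r absolutely_integrable_on {b..a}" and r0: "\<And>t. 0 \<le> r t" and C: "C > 0" and ba: "b \<le> a"
  defines "w \<equiv> (\<lambda>x. exp (C * integral {x..a} r))"
  shows "C * integral {b..a} (\<lambda>t. r t * w t) \<le> 2 * (w b - w a)"
proof -
  have ri: "r integrable_on {s..t}" if "b \<le> s" "t \<le> a" for s t
    by (rule integrable_subinterval_real[OF set_lebesgue_integral_eq_integral(1)[OF r]]) (use that in auto)
  have cont: "continuous_on {b..a} w"
    unfolding w_def by (intro continuous_intros indefinite_integral_continuous_1' ri) auto
  have rw: "(\<lambda>t. r t * w t) integrable_on {b..a}"
  proof -
    have "(\<lambda>t. w t * r t) absolutely_integrable_on {b..a}"
      by (rule absolutely_integrable_bounded_measurable_product_real[OF _ _ _ r])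
         (auto intro: continuous_imp_measurable_on_sets_lebesgue cont compact_imp_bounded compact_continuous_image)
    then show ?thesis using set_lebesgue_integral_eq_integral(1) by (simp add: mult.commute)
  qed
  have rwi: "(\<lambda>t. r t * w t) integrable_on {s..t}" if "b \<le> s" "t \<le> a" for s t
    by (rule integrable_subinterval_real[OF rw]) (use that in auto)
  have split: "integral {s..a} r = integral {s..t} r + integral {t..a} r" if "b \<le> s" "s \<le> t" "t \<le> a" for s t
    using Henstock_Kurzweil_Integration.integral_combine[OF that(2,3) ri[OF that(1)]] by simp
  have wpos: "w t > 0" for t by (simp add: w_def)
  have w_anti: "w t \<le> w s" if "b \<le> s" "s \<le> t" "t \<le> a" for s t
    using split[OF that] C integral_nonneg[OF ri[of s t]] r0 that by (simp add: w_def)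
  define P where "P s t \<longleftrightarrow> (b \<le> s \<longrightarrow> t \<le> a \<longrightarrow> C * integral {s..t} (\<lambda>t. r t * w t) \<le> 2 * (w s - w t))" for s t
  have "P b a"
  proof (rule Bolzano[OF ba])
    fix s t u assume "P s t" "P t u" "s \<le> t" "t \<le> u"
    show "P s u" unfolding P_def
    proof (intro impI)
      assume "b \<le> s" "u \<le> a"
      then have "integral {s..u} (\<lambda>t. r t * w t) = integral {s..t} (\<lambda>t. r t * w t) + integral {t..u} (\<lambda>t. r t * w t)"
        using \<open>s \<le> t\<close> \<open>t \<le> u\<close> by (intro Henstock_Kurzweil_Integration.integral_combine[symmetric] rwi) auto
      then show "C * integral {s..u} (\<lambda>t. r t * w t) \<le> 2 * (w s - w u)"
        using \<open>P s t\<close> \<open>P t u\<close> \<open>b \<le> s\<close> \<open>u \<le> a\<close> \<open>s \<le> t\<close> \<open>t \<le> u\<close> by (simp add: P_def algebra_simps)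
    qed
  next
    fix x assume x: "b \<le> x" "x \<le> a"
    \<comment> \<open>With tolerance one third, nearby values lie between 2/3 and 4/3 of
      \<open>w x\<close>, hence differ by a factor of at most 2.\<close>
    then obtain d where d: "d > 0" "\<And>y. y \<in> {b..a} \<Longrightarrow> dist y x < d \<Longrightarrow> dist (w y) (w x) < w x / 3"
      using cont[unfolded continuous_on_iff, rule_format, of x "w x / 3"] wpos[of x] by auto
    have "P s t" if st: "s \<le> x" "x \<le> t" "t - s < d" for s t
      unfolding P_def
    proof (intro impI)
      assume bs: "b \<le> s" "t \<le> a"
      have "dist (w s) (w x) < w x / 3" "dist (w t) (w x) < w x / 3"
        using d(2)[of s] d(2)[of t] bs st by (auto simp: dist_real_def)
      then have w2: "w s \<le> 2 * w t" unfolding dist_real_def abs_diff_less_iff by linarith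
      have le: "s \<le> t" using st by simp
      have "integral {s..t} (\<lambda>t. r t * w t) \<le> integral {s..t} (\<lambda>u. 2 * w t * r u)"
      proof (rule integral_le)
        fix u assume u: "u \<in> {s..t}"
        then have "w u \<le> 2 * w t" using w_anti[of s u] w2 bs by auto
        from mult_right_mono[OF this r0[of u]] show "r u * w u \<le> 2 * w t * r u" by (simp add: mult_ac)
      qed (use bs ri rwi in \<open>auto intro!: integrable_on_mult_right\<close>)
      also have "\<dots> = 2 * w t * integral {s..t} r" by simp
      finally have 1: "C * integral {s..t} (\<lambda>t. r t * w t) \<le> C * (2 * w t * integral {s..t} r)"
        using C by simp
      have "w s = w t * exp (C * integral {s..t} r)"
        using split[OF bs(1) le bs(2)] by (simp add: w_def exp_add[symmetric] algebra_simps)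
      moreover have "w t * exp (C * integral {s..t} r) \<ge> w t * (1 + C * integral {s..t} r)"
        using wpos[of t] by (intro mult_left_mono exp_ge_add_one_self) auto
      ultimately show "C * integral {s..t} (\<lambda>t. r t * w t) \<le> 2 * (w s - w t)"
        using 1 by (simp add: algebra_simps)
    qed
    then show "\<exists>d>0. \<forall>s t. s \<le> x \<and> x \<le> t \<and> t - s < d \<longrightarrow> P s t" using d(1) by blast
  qed
  then show ?thesis by (simp add: P_def)
qed

text \<open>The tail beyond \<open>a\<close> is made small once and for all; the weight then absorbs an arbitrarily
  large kernel on \<open>[0,a]\<close>.\<close>

lemma exists_kernel_weight:
  fixes r :: "real \<Rightarrow> real"
  assumes r: "integrable lebesgue r" and r0: "\<And>t. 0 \<le> r t" and eta: "\<eta> > 0"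
  obtains a where "a \<ge> 0" and "\<And>M. M \<ge> 0 \<Longrightarrow> \<exists>w W. continuous_on UNIV w \<and> (\<forall>x. 1 \<le> w x \<and> w x \<le> W) \<and>
     (\<forall>x. (LINT t|lebesgue. kernel_bound a M x t * (r t * w t)) \<le> \<eta> * w x)"
proof -
  have "eventually (\<lambda>a. (LINT t|lebesgue. indicator {a<..} t * r t) < \<eta> / 2 \<and> a \<ge> 0) at_top"
    using tail_integral_tendsto_0[OF r] eta by (intro eventually_conj order_tendstoD eventually_ge_at_top) auto
  then obtain a where a: "a \<ge> 0" and tail: "(LINT t|lebesgue. indicator {a<..} t * r t) < \<eta> / 2"
    by (auto simp: eventually_at_top_linorder)
  have "\<exists>w W. continuous_on UNIV w \<and> (\<forall>x. 1 \<le> w x \<and> w x \<le> W) \<and>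
     (\<forall>x. (LINT t|lebesgue. kernel_bound a M x t * (r t * w t)) \<le> \<eta> * w x)" if M: "M \<ge> 0" for M
  proof -
    \<comment> \<open>The weighted part on \<open>{x<..a}\<close> is at most
      \<open>M * (2 / C) * w x\<close>, and this C makes it at most half of
      \<open>\<eta> * w x\<close>. The summand 1 keeps C positive for M = 0.\<close>
    define C where "C = 4 * (M + 1) / \<eta>"
    have C: "C > 0" using M eta by (simp add: C_def)
    \<comment> \<open>Beyond \<open>a\<close> the weight is constantly 1, so the tail estimate is
      unaffected by the size of M. To the left it stays below the exponential of C times the whole
      integral of r.\<close>
    define w where "w x = exp (C * integral {min x a..a} r)" for x
    have "set_integrable lebesgue UNIV r" using r by (simp add: set_integrable_def)
    then have rab: "r absolutely_integrable_on {x..y}" for x y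
      by (rule set_integrable_subset) simp_all
    have ri: "r integrable_on {x..y}" for x y
      using set_lebesgue_integral_eq_integral(1)[OF rab] .
    have cont: "continuous_on UNIV w"
    proof -
      have "continuous_on {z..} (\<lambda>x. integral {min x a..a} r)" for z
      proof -
        have "continuous_on {min z a..a} (\<lambda>x. integral {x..a} r)"
          by (rule indefinite_integral_continuous_1'[OF ri])
        then show ?thesis
          by (rule continuous_on_compose2[where f = "\<lambda>x. min x a"]) (auto intro!: continuous_intros)
      qed
      then have "isCont (\<lambda>x. integral {min x a..a} r) x" for x
        by (rule continuous_on_interior[of "{x - 1..}"]) (simp add: interior_Ici[of "x-2"])
      then show ?thesis unfolding w_def
        by (intro continuous_intros continuous_at_imp_continuous_on) auto
    qed
    have w1: "1 \<le> w x" for x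
      using C r0 by (simp add: w_def integral_nonneg ri)
    have wW: "w x \<le> exp (C * integral UNIV r)" for x
      using C r0 by (auto simp: w_def intro!: integral_subset_le ri integrable_on_lebesgue r)
    have wa: "w t = 1" if "a \<le> t" for t using that by (simp add: w_def min_def)
    have wi: "integrable lebesgue (\<lambda>t. r t * w t)"
    proof (rule Bochner_Integration.integrable_bound)
      show "integrable lebesgue (\<lambda>t. exp (C * integral UNIV r) * r t)" using r by simp
      have "w \<in> borel_measurable lebesgue"
        using continuous_imp_measurable_on_sets_lebesgue[OF cont] by simp
      then show "(\<lambda>t. r t * w t) \<in> borel_measurable lebesgue" using r by (intro borel_measurable_times) auto
      show "AE t in lebesgue. norm (r t * w t) \<le> norm (exp (C * integral UNIV r) * r t)"
        using wW w1 r0 by (intro AE_I2) (simp add: abs_mult mult.commute mult_left_mono order.trans[OF zero_le_one])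
    qed
    have "(LINT t|lebesgue. kernel_bound a M x t * (r t * w t)) \<le> \<eta> * w x" for x
    proof -
      have i1: "integrable lebesgue (\<lambda>t. indicator {a<..} t * r t)"
        using integrable_mult_indicator[OF _ r, of "{a<..}"] by simp
      have i2: "integrable lebesgue (\<lambda>t. indicator {x<..a} t *\<^sub>R (r t * w t))"
        by (rule integrable_mult_indicator[OF _ wi]) simp
      have "(LINT t|lebesgue. kernel_bound a M x t * (r t * w t))
        = (LINT t|lebesgue. indicator {a<..} t * r t + M * (indicator {x<..a} t *\<^sub>R (r t * w t)))"
        by (intro Bochner_Integration.integral_cong) (auto simp: kernel_bound_def indicator_def wa)
      also have "\<dots> = (LINT t|lebesgue. indicator {a<..} t * r t) + M * (LINT t|lebesgue. indicator {x<..a} t *\<^sub>R (r t * w t))"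
        using i1 i2 by (subst Bochner_Integration.integral_add) simp_all
      also have "(LINT t|lebesgue. indicator {x<..a} t *\<^sub>R (r t * w t)) = integral {x..a} (\<lambda>t. r t * w t)"
        by (rule integral_Ioc_eq_integral(2)[OF i2])
      also have "\<dots> \<le> 2 * w x / C"
      proof (cases "x \<le> a")
        case True
        have "integral {x..a} (\<lambda>t. r t * w t) = integral {x..a} (\<lambda>t. r t * exp (C * integral {t..a} r))"
          by (rule integral_cong) (simp add: w_def min_def)
        moreover have "C * \<dots> \<le> 2 * (exp (C * integral {x..a} r) - exp (C * integral {a..a} r))"
          by (rule integral_exp_weight_le[OF rab r0 C True])
        ultimately have "C * integral {x..a} (\<lambda>t. r t * w t) \<le> 2 * w x"
          using True by (simp add: w_def min_def)
        then show ?thesis using C by (simp add: field_simps)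
      next
        case False
        then show ?thesis using C w1[of x] by simp
      qed
      also have "(LINT t|lebesgue. indicator {a<..} t * r t) + M * (2 * w x / C) \<le> \<eta> / 2 * w x + \<eta> / 2 * w x"
      proof (rule add_mono)
        show "(LINT t|lebesgue. indicator {a<..} t * r t) \<le> \<eta> / 2 * w x"
          using tail eta mult_left_mono[OF w1[of x], of "\<eta> / 2"] by linarith
        have "M * (2 / C) \<le> \<eta> / 2" using M eta by (simp add: C_def field_simps)
        from mult_right_mono[OF this, of "w x"] show "M * (2 * w x / C) \<le> \<eta> / 2 * w x"
          using w1[of x] by simp
      qed
      finally show ?thesis using M by (simp add: mult_left_mono)
    qed
    with cont w1 wW show ?thesis by blast
  qed
  with a that show thesis by blast
qed

section \<open>Integral operators for a single exponent\<close>

lemma at_within_atLeast_eq_Icc: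
  fixes x :: real
  shows "at x within {a..} = at x within {a..x + 1}"
  by (rule at_within_nhd[of x "{..<x + 1}"]) auto

lemma continuous_on_atLeastI:
  fixes f :: "real \<Rightarrow> 'a::topological_space"
  assumes "\<And>b. continuous_on {a..b} f"
  shows "continuous_on {a..} f"
  unfolding continuous_on_eq_continuous_within
proof
  fix x assume "x \<in> {a..}"
  then have "continuous (at x within {a..x + 1}) f"
    using assms[of "x + 1"] unfolding continuous_on_eq_continuous_within by simp
  then show "continuous (at x within {a..}) f" by (simp only: at_within_atLeast_eq_Icc)
qed

text \<open>Here \<open>\<nu> = \<lambda> - \<mu>\<close>. In every case the kernel jumps by \<open>1\<close> at \<open>t = x\<close>, which is what makes
  \<open>jost_op\<close> solve \<open>y' = \<nu> y + g\<close>; for \<open>t\<close> in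
  \<open>[0,a]\<close> it always lives on \<open>x < t\<close>.\<close>

definition jost_kernel :: "real \<Rightarrow> complex \<Rightarrow> real \<Rightarrow> real \<Rightarrow> complex" where
  "jost_kernel a \<nu> x t =
     (if Re \<nu> < 0 \<and> a < t then (if t \<le> x then exp (\<nu> * of_real (x - t)) else 0)
      else (if t \<le> x then 0 else - exp (\<nu> * of_real (x - t))))"

definition jost_op :: "real \<Rightarrow> complex \<Rightarrow> (real \<Rightarrow> complex) \<Rightarrow> real \<Rightarrow> complex" where
  "jost_op a \<nu> g x = (LINT t|lebesgue. jost_kernel a \<nu> x t * g t)"

text \<open>Beyond \<open>a\<close> the direction of integration is chosen so that
  \<open>Re \<nu> * (x - t) \<le> 0\<close> on the support. For \<open>t \<le> a\<close> the support
  has 0 \<le> x < t \<le> a, so the exponent is at most \<open>cmod \<nu> * a\<close>, whatever the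
  sign of \<open>Re \<nu>\<close>.\<close>

lemma jost_kernel_bound:
  assumes "0 < t" "0 \<le> x" and M: "M \<ge> exp (cmod \<nu> * a)"
  shows "cmod (jost_kernel a \<nu> x t) \<le> kernel_bound a M x t"
proof -
  have ln: "cmod (exp (\<nu> * of_real (x - t))) = exp (Re \<nu> * (x - t))"
    by (simp add: norm_exp_eq_Re)
  show ?thesis
  proof (cases "a < t")
    case True
    then show ?thesis
      unfolding jost_kernel_def kernel_bound_def
      by (auto simp: ln mult_nonpos_nonneg mult_nonneg_nonpos simp del: of_real_diff)
  next
    case False
    have "exp (Re \<nu> * (x - t)) \<le> M" if "x < t"
    proof -
      have "Re \<nu> * (x - t) \<le> \<bar>Re \<nu>\<bar> * \<bar>x - t\<bar>" by (metis abs_ge_self abs_mult)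
      also have "\<dots> \<le> cmod \<nu> * a"
        using that False assms by (intro mult_mono abs_Re_le_cmod) auto
      finally have "exp (Re \<nu> * (x - t)) \<le> exp (cmod \<nu> * a)" by simp
      then show ?thesis using M by linarith
    qed
    with False show ?thesis
      unfolding jost_kernel_def kernel_bound_def
      by (auto simp: ln simp del: of_real_diff)
  qed
qed

lemma jost_kernel_measurable [measurable]: "jost_kernel a \<nu> x \<in> borel_measurable borel"
  unfolding jost_kernel_def by measurable

lemma jost_kernel_measurable_lebesgue: "jost_kernel a \<nu> x \<in> borel_measurable lebesgue"
  by (rule measurable_completion) simp

context
  fixes a :: real and g :: "real \<Rightarrow> complex"
  assumes a0: "a \<ge> 0" and g: "integrable lebesgue g" and g0: "\<And>t. t \<le> 0 \<Longrightarrow> g t = 0"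
begin

lemma jost_kernel_mult_bound:
  assumes "0 \<le> x" "M \<ge> exp (cmod \<nu> * a)"
  shows "cmod (jost_kernel a \<nu> x t * g t) \<le> kernel_bound a M x t * cmod (g t)"
  using jost_kernel_bound[OF _ assms(1), of t \<nu> a M] assms(2) g0[of t]
  by (cases "0 < t") (auto simp: norm_mult intro: mult_right_mono)

lemma kernel_bound_ge_one: "1 \<le> exp (cmod \<nu> * a)"
  using a0 by simp

lemma jost_kernel_mult_bound':
  assumes "0 \<le> x"
  shows "cmod (jost_kernel a \<nu> x t * g t) \<le> exp (cmod \<nu> * a) * cmod (g t)"
proof -
  have "kernel_bound a (exp (cmod \<nu> * a)) x t * cmod (g t) \<le> exp (cmod \<nu> * a) * cmod (g t)"
    by (intro mult_right_mono kernel_bound_le kernel_bound_ge_one) simp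
  with jost_kernel_mult_bound[OF assms order_refl] show ?thesis by (rule order_trans)
qed

lemma jost_kernel_mult_measurable: "(\<lambda>t. jost_kernel a \<nu> x t * g t) \<in> borel_measurable lebesgue"
  using g by (intro borel_measurable_times jost_kernel_measurable_lebesgue) auto

lemma jost_kernel_mult_integrable:
  assumes "0 \<le> x"
  shows "integrable lebesgue (\<lambda>t. jost_kernel a \<nu> x t * g t)"
proof (rule Bochner_Integration.integrable_bound[OF _ jost_kernel_mult_measurable])
  show "integrable lebesgue (\<lambda>t. exp (cmod \<nu> * a) * cmod (g t))" using g by simp
qed (use jost_kernel_mult_bound'[OF assms] in auto)

lemma jost_op_bound:
  assumes x: "0 \<le> x" and M: "M \<ge> exp (cmod \<nu> * a)" and le: "\<And>t. cmod (g t) \<le> r t" and r: "integrable lebesgue r"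
  shows "cmod (jost_op a \<nu> g x) \<le> (LINT t|lebesgue. kernel_bound a M x t * r t)"
  unfolding jost_op_def
proof (rule Bochner_Integration.integral_norm_bound_integral)
  have M1: "1 \<le> M" using kernel_bound_ge_one[of \<nu>] M by linarith
  have r0: "0 \<le> r t" for t using le[of t] norm_ge_zero order_trans by blast
  have "kernel_bound a M x \<in> borel_measurable lebesgue"
    using kernel_bound_measurable by (simp add: measurable_completion)
  then have m: "(\<lambda>t. kernel_bound a M x t * r t) \<in> borel_measurable lebesgue"
    using r by (intro borel_measurable_times) auto
  show "integrable lebesgue (\<lambda>t. kernel_bound a M x t * r t)"
    by (rule Bochner_Integration.integrable_bound[OF _ m, of "\<lambda>t. M * r t"])
       (use r M1 r0 in \<open>auto simp: abs_mult kernel_bound_nonneg kernel_bound_le intro!: mult_right_mono\<close>)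
  show "cmod (jost_kernel a \<nu> x t * g t) \<le> kernel_bound a M x t * r t" for t
    using jost_kernel_mult_bound[OF x M, of t] mult_left_mono[OF le[of t], of "kernel_bound a M x t"]
      kernel_bound_nonneg[of M a x t] M1 by linarith
qed (rule jost_kernel_mult_integrable[OF x])

text \<open>For fixed t the kernel decays exponentially in x when \<open>Re \<nu> < 0\<close> and
  \<open>a < t\<close>, and otherwise it is 0 once \<open>x \<ge> t\<close>. In particular a purely
  oscillating exponential is integrated from infinity, where no decay is asked of it. A fixed
  multiple of |g| dominates for all x \<ge> 0.\<close>

lemma jost_op_tendsto_0: "(jost_op a \<nu> g \<longlongrightarrow> 0) at_top"
proof -
  have "((\<lambda>x. LINT t|lebesgue. jost_kernel a \<nu> x t * g t) \<longlongrightarrow> (LINT t|(lebesgue::real measure). 0)) at_top"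
  proof (rule integral_dominated_convergence_at_top[where w = "\<lambda>t. exp (cmod \<nu> * a) * cmod (g t)"])
    show "AE t in lebesgue. ((\<lambda>x. jost_kernel a \<nu> x t * g t) \<longlongrightarrow> 0) at_top"
    proof (rule AE_I2)
      fix t :: real
      have "((\<lambda>x. jost_kernel a \<nu> x t) \<longlongrightarrow> 0) at_top"
      proof (cases "Re \<nu> < 0 \<and> a < t")
        case True
        have "((\<lambda>x. exp (Re \<nu> * (x - t))) \<longlongrightarrow> 0) at_top"
        proof (rule filterlim_compose[OF exp_at_bot])
          have "filterlim (\<lambda>x. x - t) at_top at_top"
            using filterlim_tendsto_add_at_top[of "\<lambda>_. -t" "-t" at_top "\<lambda>x. x"] by (simp add: filterlim_ident)
          then show "filterlim (\<lambda>x. Re \<nu> * (x - t)) at_bot at_top"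
            using True by (intro filterlim_tendsto_neg_mult_at_bot[OF tendsto_const]) auto
        qed
        then have "((\<lambda>x. exp (\<nu> * of_real (x - t))) \<longlongrightarrow> 0) at_top"
          by (intro tendsto_norm_zero_cancel[of "\<lambda>x. exp (\<nu> * of_real (x - t))"]) (simp add: norm_exp_eq_Re)
        moreover have "eventually (\<lambda>x. exp (\<nu> * of_real (x - t)) = jost_kernel a \<nu> x t) at_top"
          using eventually_ge_at_top[of t] by eventually_elim (use True in \<open>simp add: jost_kernel_def\<close>)
        ultimately show ?thesis by (rule Lim_transform_eventually)
      next
        case False
        then have "eventually (\<lambda>x. jost_kernel a \<nu> x t = 0) at_top"
          using eventually_ge_at_top[of t] by (auto simp: jost_kernel_def elim: eventually_mono)
        then show ?thesis by (rule tendsto_eventually)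
      qed
      then show "((\<lambda>x. jost_kernel a \<nu> x t * g t) \<longlongrightarrow> 0) at_top"
        by (rule tendsto_mult_left_zero)
    qed
    show "eventually (\<lambda>x. AE t in lebesgue. cmod (jost_kernel a \<nu> x t * g t) \<le> exp (cmod \<nu> * a) * cmod (g t)) at_top"
      using eventually_ge_at_top[of 0] by eventually_elim (use jost_kernel_mult_bound' in auto)
  qed (use g jost_kernel_mult_measurable in auto)
  then show ?thesis by (simp add: jost_op_def[abs_def])
qed

lemma exp_mult_absolutely_integrable:
  fixes \<nu> :: complex
  shows "(\<lambda>t. exp (\<nu> * of_real t) * g t) absolutely_integrable_on {x..y}"
proof (rule absolutely_integrable_bounded_measurable_product[of "(*)"])
  have c: "continuous_on {x..y} (\<lambda>t. exp (\<nu> * complex_of_real t))" by (intro continuous_intros)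
  show "(\<lambda>t. exp (\<nu> * of_real t)) \<in> borel_measurable (lebesgue_on {x..y})"
    by (rule continuous_imp_measurable_on_sets_lebesgue[OF c]) simp
  show "bounded ((\<lambda>t. exp (\<nu> * complex_of_real t)) ` {x..y})"
    using c by (intro compact_imp_bounded compact_continuous_image) auto
  have "set_integrable lebesgue UNIV g" using g by (simp add: set_integrable_def)
  then show "g absolutely_integrable_on {x..y}" by (rule set_integrable_subset) simp_all
qed (simp_all add: bilinear_times)

text \<open>For t > 0 and either direction of integration, the kernel at x is
  \<open>exp (\<nu> * x)\<close> times the sum of the kernel at 0 and
  \<open>exp (- \<nu> * t)\<close> restricted to \<open>t \<le> x\<close>. The choice of lower limit
  therefore survives only in the initial value \<open>jost_op a \<nu> g 0\<close>.\<close>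

lemma jost_op_representation:
  assumes x: "0 \<le> x"
  shows "jost_op a \<nu> g x = exp (\<nu> * of_real x) *
          (jost_op a \<nu> g 0 + integral {0..x} (\<lambda>t. exp (- \<nu> * of_real t) * g t))"
proof -
  let ?h = "\<lambda>t. indicator {0<..x} t *\<^sub>R (exp (- \<nu> * of_real t) * g t)"
  have i0: "integrable lebesgue (\<lambda>t. jost_kernel a \<nu> 0 t * g t)"
    by (rule jost_kernel_mult_integrable) simp
  have h: "integrable lebesgue ?h"
  proof -
    have "(\<lambda>t. exp (- \<nu> * of_real t) * g t) absolutely_integrable_on {0<..x}"
      by (rule set_integrable_subset[OF exp_mult_absolutely_integrable[where \<nu> = "- \<nu>" and x = 0 and y = x]]) auto
    then show ?thesis by (simp add: set_integrable_def)
  qed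
  have ex: "exp (\<nu> * of_real (x - t)) = exp (\<nu> * of_real x) * exp (- \<nu> * of_real t)" for t
    by (simp add: exp_add[symmetric] algebra_simps)
  have "jost_kernel a \<nu> x t * g t = exp (\<nu> * of_real x) * (jost_kernel a \<nu> 0 t * g t + ?h t)" for t
  proof (cases "t \<le> 0")
    case False
    then have K: "jost_kernel a \<nu> x t = exp (\<nu> * of_real x) * (jost_kernel a \<nu> 0 t + indicator {0<..x} t *\<^sub>R exp (- \<nu> * of_real t))"
      unfolding jost_kernel_def ex using x by (auto simp: algebra_simps indicator_def)
    show ?thesis unfolding K by (simp add: algebra_simps)
  qed (simp add: g0)
  then have "jost_op a \<nu> g x = (LINT t|lebesgue. exp (\<nu> * of_real x) * (jost_kernel a \<nu> 0 t * g t + ?h t))"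
    by (simp add: jost_op_def)
  also have "\<dots> = exp (\<nu> * of_real x) * (jost_op a \<nu> g 0 + (LINT t|lebesgue. ?h t))"
    using i0 h by (simp add: jost_op_def)
  also have "(LINT t|lebesgue. ?h t) = integral {0..x} (\<lambda>t. exp (- \<nu> * of_real t) * g t)"
    by (rule integral_Ioc_eq_integral(2)[OF h])
  finally show ?thesis .
qed

lemma continuous_on_jost_op: "continuous_on {0..} (jost_op a \<nu> g)"
proof -
  have "continuous_on {0..b} (\<lambda>x. exp (\<nu> * of_real x) *
          (jost_op a \<nu> g 0 + integral {0..x} (\<lambda>t. exp (- \<nu> * of_real t) * g t)))" for b
    by (intro continuous_intros indefinite_integral_continuous_1
          set_lebesgue_integral_eq_integral(1) exp_mult_absolutely_integrable)
  then have "continuous_on {0..b} (jost_op a \<nu> g)" for b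
    by (rule continuous_on_eq) (rule jost_op_representation[symmetric], simp)
  then show ?thesis
    by (rule continuous_on_atLeastI)
qed

end

lemma jost_op_diff:
  assumes "a \<ge> 0" "0 \<le> x" "integrable lebesgue g" "integrable lebesgue h"
    "\<And>t. t \<le> 0 \<Longrightarrow> g t = 0" "\<And>t. t \<le> 0 \<Longrightarrow> h t = 0"
  shows "jost_op a \<nu> g x - jost_op a \<nu> h x = jost_op a \<nu> (\<lambda>t. g t - h t) x"
  unfolding jost_op_def
  by (subst Bochner_Integration.integral_diff[symmetric]) (use assms in \<open>auto intro!: jost_kernel_mult_integrable simp: right_diff_distrib\<close>)

section \<open>Variation of constants\<close>

lemma lebesgue_differentiation_half_line:
  fixes f :: "real \<Rightarrow> 'b::euclidean_space"
  assumes f: "\<And>b. f integrable_on {0..b}"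
  shows "AE x in lebesgue. 0 < x \<longrightarrow> ((\<lambda>u. integral {0..u} f) has_vector_derivative f x) (at x)"
proof -
  define N where "N n = {x \<in> {0<..<real n}. \<not> ((\<lambda>u. integral {0..u} f) has_vector_derivative f x) (at x)}" for n
  have "negligible (\<Union>n. N n)"
    unfolding N_def by (intro negligible_Union_nat lebesgue_differentiation_interval f)
  then have "AE x in lebesgue. x \<notin> (\<Union>n. N n)"
    by (simp only: negligible_iff_null_sets AE_not_in)
  then show ?thesis
  proof eventually_elim
    fix x assume x: "x \<notin> (\<Union>n. N n)"
    show "0 < x \<longrightarrow> ((\<lambda>u. integral {0..u} f) has_vector_derivative f x) (at x)"
      using x reals_Archimedean2[of x] by (auto simp: N_def)
  qed
qed

lemma norm_exp_minus_one_le: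
  fixes z :: complex
  assumes "cmod z \<le> c"
  shows "cmod (exp z - 1) \<le> exp c * cmod z"
proof -
  have "cmod (exp z - 1) \<le> exp \<bar>Re z\<bar> * cmod z" using Taylor_exp[of z 0] by simp
  also have "\<dots> \<le> exp c * cmod z"
    using assms abs_Re_le_cmod[of z] by (intro mult_right_mono) auto
  finally show ?thesis .
qed

lemma has_vector_derivative_exp_mult:
  "((\<lambda>x. exp (c * complex_of_real x)) has_vector_derivative c * exp (c * of_real x)) (at x within S)"
proof -
  have "((\<lambda>z. exp (c * z)) has_field_derivative c * exp (c * of_real x)) (at (of_real x))"
    by (auto intro!: derivative_eq_intros)
  then show ?thesis by (rule has_vector_derivative_real_field)
qed

lemma integral_diff_Icc:
  fixes f :: "real \<Rightarrow> 'a::banach"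
  assumes "\<And>b. f integrable_on {0..b}" "0 \<le> s" "s \<le> t"
  shows "integral {0..t} f - integral {0..s} f = integral {s..t} f"
  using Henstock_Kurzweil_Integration.integral_combine[OF assms(2,3,1)] by (simp add: algebra_simps)

text \<open>The increment of a product E A is (E t - E s) A t + E s (A t - A s). The first term is
  Lipschitz in t - s, which accounts for the constant K in \<open>\<phi>\<close>; the second is at
  most the bound \<open>M2\<close> of E times the integral of |h|.\<close>

lemma exp_mult_primitive_dominated:
  fixes h :: "real \<Rightarrow> complex" and c :: complex
  assumes h: "\<And>b. h absolutely_integrable_on {0..b}"
  obtains \<phi> where "\<phi> integrable_on {0..b}" "\<And>x. 0 \<le> \<phi> x"
    "\<And>s t. \<lbrakk>0 \<le> s; s \<le> t; t \<le> b\<rbrakk> \<Longrightarrow> cmod (exp (c * of_real t) * (\<alpha> + integral {0..t} h)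
        - exp (c * of_real s) * (\<alpha> + integral {0..s} h)) \<le> integral {s..t} \<phi>"
proof -
  have hi: "h integrable_on {s..t}" and ni: "(\<lambda>x. cmod (h x)) integrable_on {s..t}" if "0 \<le> s" for s t
  proof -
    have "h absolutely_integrable_on {s..t}" by (rule set_integrable_subset[OF h[of t]]) (use that in auto)
    then show "h integrable_on {s..t}" "(\<lambda>x. cmod (h x)) integrable_on {s..t}"
      by (auto simp: absolutely_integrable_on_def)
  qed
  define A where "A t = \<alpha> + integral {0..t} h" for t
  have "continuous_on {0..b} A" "continuous_on {0..b} (\<lambda>t. exp (c * complex_of_real t))"
    unfolding A_def by (intro continuous_intros indefinite_integral_continuous_1 hi order_refl)+
  then have "bounded (A ` {0..b})" "bounded ((\<lambda>t. exp (c * complex_of_real t)) ` {0..b})"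
    by (intro compact_imp_bounded compact_continuous_image; simp)+
  then obtain M1 M2 where M: "M1 > 0" "M2 > 0" "\<And>t. t \<in> {0..b} \<Longrightarrow> cmod (A t) \<le> M1"
     "\<And>t. t \<in> {0..b} \<Longrightarrow> cmod (exp (c * complex_of_real t)) \<le> M2"
    unfolding bounded_pos by (auto simp del: norm_exp_eq_Re)
  define K where "K = M2 * (exp (cmod c * b) * cmod c) * M1"
  define \<phi> where "\<phi> x = K + M2 * cmod (h x)" for x
  show thesis
  proof (rule that)
    show "\<phi> integrable_on {0..b}" unfolding \<phi>_def
      by (intro integrable_add integrable_on_mult_right ni) auto
    show "0 \<le> \<phi> x" for x using M by (simp add: \<phi>_def K_def)
    fix s t assume st: "0 \<le> s" "s \<le> t" "t \<le> b"
    have e: "exp (c * complex_of_real t) - exp (c * of_real s) = exp (c * of_real s) * (exp (c * of_real (t - s)) - 1)"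
      by (simp add: algebra_simps exp_add[symmetric])
    have "cmod (c * complex_of_real (t - s)) \<le> cmod c * b"
      unfolding norm_mult norm_of_real using st by (intro mult_left_mono) auto
    from norm_exp_minus_one_le[OF this]
    have "cmod (exp (c * complex_of_real (t - s)) - 1) \<le> exp (cmod c * b) * cmod c * (t - s)"
      using st by (simp add: norm_mult mult.assoc del: of_real_diff)
    then have "cmod (exp (c * complex_of_real t) - exp (c * of_real s)) \<le> M2 * (exp (cmod c * b) * cmod c * (t - s))"
      unfolding e norm_mult using M st by (intro mult_mono) auto
    then have "cmod ((exp (c * complex_of_real t) - exp (c * of_real s)) * A t) \<le> M2 * (exp (cmod c * b) * cmod c * (t - s)) * M1"
      unfolding norm_mult using M st by (intro mult_mono) auto
    also have "\<dots> = K * (t - s)" by (simp add: K_def)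
    finally have 1: "cmod ((exp (c * complex_of_real t) - exp (c * of_real s)) * A t) \<le> K * (t - s)" .
    have "A t - A s = integral {s..t} h"
      using integral_diff_Icc[of h s t] hi st by (simp add: A_def)
    moreover have "cmod (integral {s..t} h) \<le> integral {s..t} (\<lambda>x. cmod (h x))"
      by (rule Henstock_Kurzweil_Integration.integral_norm_bound_integral) (use hi ni st in auto)
    ultimately have 2: "cmod (exp (c * complex_of_real s) * (A t - A s)) \<le> M2 * integral {s..t} (\<lambda>x. cmod (h x))"
      unfolding norm_mult using M st by (intro mult_mono) auto
    have "exp (c * complex_of_real t) * A t - exp (c * of_real s) * A s =
        (exp (c * complex_of_real t) - exp (c * of_real s)) * A t + exp (c * complex_of_real s) * (A t - A s)"
      by (simp add: algebra_simps)
    then have "cmod (exp (c * complex_of_real t) * A t - exp (c * of_real s) * A s)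
       \<le> K * (t - s) + M2 * integral {s..t} (\<lambda>x. cmod (h x))"
      using norm_triangle_le[OF add_mono[OF 1 2]] by simp
    also have "\<dots> = integral {s..t} \<phi>"
      unfolding \<phi>_def using st ni[of s t]
      by (subst integral_add) (auto intro!: integrable_on_mult_right simp: mult.commute)
    finally show "cmod (exp (c * of_real t) * (\<alpha> + integral {0..t} h)
        - exp (c * of_real s) * (\<alpha> + integral {0..s} h)) \<le> integral {s..t} \<phi>"
      by (simp add: A_def)
  qed
qed

text \<open>\<open>voc_u\<close> and \<open>voc_p\<close> are the solution of \<open>u'' = l\<^sup>2 u + G\<close> given by variation of constants, and its
  derivative.\<close>

context
  fixes l \<alpha> \<beta> :: complex and G :: "real \<Rightarrow> complex"
  assumes l: "l \<noteq> 0"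
    and G: "\<And>(c::complex) b. (\<lambda>t. exp (c * of_real t) * G t) absolutely_integrable_on {0..b}"
begin

definition voc_u :: "real \<Rightarrow> complex" where
  "voc_u x = (exp (l * of_real x) * (\<alpha> + integral {0..x} (\<lambda>t. exp (- l * of_real t) * G t))
      - exp (- l * of_real x) * (\<beta> + integral {0..x} (\<lambda>t. exp (l * of_real t) * G t))) / (2 * l)"

definition voc_p :: "real \<Rightarrow> complex" where
  "voc_p x = (exp (l * of_real x) * (\<alpha> + integral {0..x} (\<lambda>t. exp (- l * of_real t) * G t))
      + exp (- l * of_real x) * (\<beta> + integral {0..x} (\<lambda>t. exp (l * of_real t) * G t))) / 2"

lemma voc_integrable:
  fixes c :: complex
  shows "0 \<le> s \<Longrightarrow> (\<lambda>t. exp (c * of_real t) * G t) absolutely_integrable_on {s..b}"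
  by (rule set_integrable_subset[OF G[where b = b]]) auto

lemma voc_integrable_on:
  fixes c :: complex
  shows "0 \<le> s \<Longrightarrow> (\<lambda>t. exp (c * of_real t) * G t) integrable_on {s..b}"
  using voc_integrable by (auto simp: absolutely_integrable_on_def)

lemma G_integrable: "0 \<le> s \<Longrightarrow> (\<lambda>t. cmod (G t)) integrable_on {s..b}"
  using voc_integrable[of s b 0] by (auto simp: absolutely_integrable_on_def)

text \<open>Under one integral sign the two exponentials combine to 2 sinh (l (y - x)), which is of
  order y - x; this yields the extra factor t - s. The restriction t \<le> s + 1 keeps the constant
  in the exponential estimate uniform.\<close>

lemma voc_remainder_bound:
  assumes st: "0 \<le> s" "s \<le> t" "t \<le> s + 1" and y: "y \<in> {s..t}"
  shows "cmod (exp (l * of_real y) * integral {s..t} (\<lambda>t. exp (- l * of_real t) * G t)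
      - exp (- l * of_real y) * integral {s..t} (\<lambda>t. exp (l * of_real t) * G t))
     \<le> 2 * exp (cmod l) * cmod l * (t - s) * integral {s..t} (\<lambda>x. cmod (G x))"
proof -
  have i1: "(\<lambda>t. exp (l * of_real y) * (exp (- l * of_real t) * G t)) integrable_on {s..t}"
    and i2: "(\<lambda>t. exp (- l * of_real y) * (exp (l * of_real t) * G t)) integrable_on {s..t}"
    by (rule integrable_on_mult_right, rule voc_integrable_on, rule st(1))+
  have "exp (l * of_real y) * integral {s..t} (\<lambda>t. exp (- l * of_real t) * G t)
      - exp (- l * of_real y) * integral {s..t} (\<lambda>t. exp (l * of_real t) * G t)
    = integral {s..t} (\<lambda>t. exp (l * of_real y) * (exp (- l * of_real t) * G t) - exp (- l * of_real y) * (exp (l * of_real t) * G t))"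
    by (subst integral_diff[OF i1 i2]) simp
  also have "cmod \<dots> \<le> integral {s..t} (\<lambda>x. 2 * exp (cmod l) * cmod l * (t - s) * cmod (G x))"
  proof (rule Henstock_Kurzweil_Integration.integral_norm_bound_integral)
    show "(\<lambda>x. 2 * exp (cmod l) * cmod l * (t - s) * cmod (G x)) integrable_on {s..t}"
      using st by (intro integrable_on_mult_right G_integrable)
    fix x assume x: "x \<in> {s..t}"
    define z where "z = l * complex_of_real (y - x)"
    have yx: "\<bar>y - x\<bar> \<le> t - s" using x y by auto
    have z1: "cmod z \<le> cmod l * (t - s)"
      unfolding z_def norm_mult norm_of_real using yx by (intro mult_left_mono) auto
    have z2: "cmod z \<le> cmod l"
      using z1 mult_left_mono[of "t - s" 1 "cmod l"] st by simp
    have "exp (l * of_real y) * (exp (- l * of_real x) * G x) - exp (- l * of_real y) * (exp (l * of_real x) * G x)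
      = ((exp z - 1) - (exp (- z) - 1)) * G x"
      by (simp add: z_def algebra_simps exp_add[symmetric])
    also have "cmod \<dots> \<le> (cmod (exp z - 1) + cmod (exp (- z) - 1)) * cmod (G x)"
      unfolding norm_mult by (intro mult_right_mono norm_triangle_ineq4) simp
    also have "\<dots> \<le> (exp (cmod l) * cmod z + exp (cmod l) * cmod z) * cmod (G x)"
      using norm_exp_minus_one_le[of z "cmod l"] norm_exp_minus_one_le[of "-z" "cmod l"] z2
      by (intro mult_right_mono add_mono) auto
    also have "\<dots> = 2 * exp (cmod l) * cmod z * cmod (G x)" by simp
    also have "\<dots> \<le> 2 * exp (cmod l) * (cmod l * (t - s)) * cmod (G x)"
      using z1 by (intro mult_right_mono mult_left_mono) auto
    finally show "cmod (exp (l * of_real y) * (exp (- l * of_real x) * G x) - exp (- l * of_real y) * (exp (l * of_real x) * G x))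
      \<le> 2 * exp (cmod l) * cmod l * (t - s) * cmod (G x)" by (simp add: mult.assoc)
  qed (intro integrable_diff i1 i2)
  finally show ?thesis by simp
qed

text \<open>\<open>voc_u\<close> is continuously differentiable although the integrals in it are only absolutely
  continuous: to first order, their increments cancel.\<close>

lemma voc_u_derivative:
  assumes x: "0 \<le> x"
  shows "(voc_u has_vector_derivative voc_p x) (at x within {0..})"
proof -
  define A where "A y = \<alpha> + integral {0..y} (\<lambda>t. exp (- l * of_real t) * G t)" for y
  define B where "B y = \<beta> + integral {0..y} (\<lambda>t. exp (l * of_real t) * G t)" for y
  \<comment> \<open>D freezes the coefficients at x and carries the whole derivative. R collects
    their increments and is |y - x| times a factor tending to 0, the increment of the primitive
    \<open>\<Phi>\<close> of |G|.\<close>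
  define D where "D y = (exp (l * of_real y) * A x - exp (- l * of_real y) * B x) / (2 * l)" for y
  define R where "R y = (exp (l * of_real y) * (A y - A x) - exp (- l * of_real y) * (B y - B x)) / (2 * l)" for y
  define \<Phi> where "\<Phi> y = integral {0..y} (\<lambda>t. cmod (G t))" for y
  have u: "voc_u y = D y + R y" for y
    by (simp add: voc_u_def D_def R_def A_def B_def add_divide_distrib[symmetric] algebra_simps)
  have "(D has_vector_derivative (l * exp (l * of_real x) * A x - (- l) * exp (- l * of_real x) * B x) / (2 * l)) (at x within {0..})"
    unfolding D_def
    by (intro has_vector_derivative_divide has_vector_derivative_diff has_vector_derivative_mult_left has_vector_derivative_exp_mult)
  moreover have "(l * exp (l * of_real x) * A x - (- l) * exp (- l * of_real x) * B x) / (2 * l) = voc_p x"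
    using l by (simp add: voc_p_def A_def B_def field_simps)
  ultimately have D: "(D has_vector_derivative voc_p x) (at x within {0..})" by simp
  have bound: "cmod (R y) \<le> exp (cmod l) * \<bar>y - x\<bar> * \<bar>\<Phi> y - \<Phi> x\<bar>" if y: "0 \<le> y" "\<bar>y - x\<bar> \<le> 1" for y
  proof -
    define s t where "s = min x y" and "t = max x y"
    have st: "0 \<le> s" "s \<le> t" "t \<le> s + 1" "y \<in> {s..t}" "t - s = \<bar>y - x\<bar>"
      using x y by (auto simp: s_def t_def)
    have dA: "A t - A s = integral {s..t} (\<lambda>t. exp (- l * of_real t) * G t)"
      and dB: "B t - B s = integral {s..t} (\<lambda>t. exp (l * of_real t) * G t)"
      and dP: "\<Phi> t - \<Phi> s = integral {s..t} (\<lambda>t. cmod (G t))"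
      unfolding A_def B_def \<Phi>_def add_diff_cancel_left
      by (rule integral_diff_Icc[OF _ st(1,2)], rule voc_integrable_on G_integrable, simp)+
    have num: "2 * l * R y = exp (l * of_real y) * (A y - A x) - exp (- l * of_real y) * (B y - B x)"
      using l by (simp add: R_def)
    have "cmod (2 * l * R y) = cmod (exp (l * of_real y) * (A t - A s) - exp (- l * of_real y) * (B t - B s))"
    proof (cases "x \<le> y")
      case True
      then show ?thesis unfolding num by (simp add: s_def t_def)
    next
      case False
      then have "2 * l * R y = - (exp (l * of_real y) * (A t - A s) - exp (- l * of_real y) * (B t - B s))"
        unfolding num by (simp add: s_def t_def algebra_simps)
      then show ?thesis by (simp only: norm_minus_cancel)
    qed
    also have "\<dots> \<le> 2 * exp (cmod l) * cmod l * (t - s) * (\<Phi> t - \<Phi> s)"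
      unfolding dA dB dP by (rule voc_remainder_bound[OF st(1-4)])
    also have "\<dots> \<le> 2 * exp (cmod l) * cmod l * (t - s) * \<bar>\<Phi> t - \<Phi> s\<bar>"
      using st by (intro mult_left_mono) auto
    also have "\<bar>\<Phi> t - \<Phi> s\<bar> = \<bar>\<Phi> y - \<Phi> x\<bar>" by (auto simp: s_def t_def min_def max_def)
    finally have "2 * cmod l * cmod (R y) \<le> 2 * cmod l * (exp (cmod l) * \<bar>y - x\<bar> * \<bar>\<Phi> y - \<Phi> x\<bar>)"
      unfolding st(5) norm_mult by (simp add: mult_ac)
    then show ?thesis using l by simp
  qed
  have "(R has_derivative (\<lambda>h. h *\<^sub>R 0)) (at x within {0..})"
  proof (rule has_derivativeI_sandwich[of 1])
    fix y assume y: "y \<in> {0..}" "y \<noteq> x" "dist y x < 1"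
    have "R x = 0" by (simp add: R_def)
    then show "norm (R y - R x - (y - x) *\<^sub>R 0) / norm (y - x) \<le> exp (cmod l) * \<bar>\<Phi> y - \<Phi> x\<bar>"
      using bound[of y] y by (simp add: dist_real_def divide_le_eq mult_ac)
  next
    have "continuous_on {0..} \<Phi>"
      unfolding \<Phi>_def by (intro continuous_on_atLeastI indefinite_integral_continuous_1 G_integrable) simp
    then have "(\<Phi> \<longlongrightarrow> \<Phi> x) (at x within {0..})"
      using x by (auto simp: continuous_on_def)
    then have "((\<lambda>y. exp (cmod l) * \<bar>\<Phi> y - \<Phi> x\<bar>) \<longlongrightarrow> exp (cmod l) * \<bar>\<Phi> x - \<Phi> x\<bar>) (at x within {0..})"
      by (intro tendsto_intros)
    then show "((\<lambda>y. exp (cmod l) * \<bar>\<Phi> y - \<Phi> x\<bar>) \<longlongrightarrow> 0) (at x within {0..})" by simp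
  qed auto
  then have "(R has_vector_derivative 0) (at x within {0..})"
    by (simp add: has_vector_derivative_def)
  from has_vector_derivative_add[OF D this] show ?thesis
    by (simp add: u[abs_def])
qed

lemma voc_p_dominated:
  obtains \<phi> where "\<phi> integrable_on {0..b}" "\<And>x. 0 \<le> \<phi> x"
    "\<And>s t. \<lbrakk>0 \<le> s; s \<le> t; t \<le> b\<rbrakk> \<Longrightarrow> cmod (voc_p t - voc_p s) \<le> integral {s..t} \<phi>"
proof -
  obtain \<phi>1 where 1: "\<phi>1 integrable_on {0..b}" "\<And>x. 0 \<le> \<phi>1 x"
    "\<And>s t. \<lbrakk>0 \<le> s; s \<le> t; t \<le> b\<rbrakk> \<Longrightarrow> cmod (exp (l * of_real t) * (\<alpha> + integral {0..t} (\<lambda>t. exp (- l * of_real t) * G t))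
        - exp (l * of_real s) * (\<alpha> + integral {0..s} (\<lambda>t. exp (- l * of_real t) * G t))) \<le> integral {s..t} \<phi>1"
    using exp_mult_primitive_dominated[OF G] by blast
  obtain \<phi>2 where 2: "\<phi>2 integrable_on {0..b}" "\<And>x. 0 \<le> \<phi>2 x"
    "\<And>s t. \<lbrakk>0 \<le> s; s \<le> t; t \<le> b\<rbrakk> \<Longrightarrow> cmod (exp (- l * of_real t) * (\<beta> + integral {0..t} (\<lambda>t. exp (l * of_real t) * G t))
        - exp (- l * of_real s) * (\<beta> + integral {0..s} (\<lambda>t. exp (l * of_real t) * G t))) \<le> integral {s..t} \<phi>2"
    using exp_mult_primitive_dominated[OF G] by blast
  show thesis
  proof (rule that)
    show "(\<lambda>x. \<phi>1 x + \<phi>2 x) integrable_on {0..b}" using 1 2 by (intro integrable_add)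
    show "0 \<le> \<phi>1 x + \<phi>2 x" for x using 1 2 by simp
    fix s t assume st: "0 \<le> s" "s \<le> t" "t \<le> b"
    have half: "cmod ((x + y) / 2 - (x' + y') / 2) \<le> A + B" if "cmod (x - x') \<le> A" "cmod (y - y') \<le> B" for x y x' y' A B
    proof -
      have "cmod ((x + y) / 2 - (x' + y') / 2) = cmod ((x - x') + (y - y')) / 2"
        by (simp add: diff_divide_distrib[symmetric] norm_divide algebra_simps)
      also have "\<dots> \<le> cmod ((x - x') + (y - y'))" by simp
      also have "\<dots> \<le> A + B" using that by (intro norm_triangle_mono)
      finally show ?thesis .
    qed
    have "\<phi>1 integrable_on {s..t}" "\<phi>2 integrable_on {s..t}"
      by (rule integrable_subinterval_real[OF 1(1)] integrable_subinterval_real[OF 2(1)]; use st in auto)+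
    then have "integral {s..t} (\<lambda>x. \<phi>1 x + \<phi>2 x) = integral {s..t} \<phi>1 + integral {s..t} \<phi>2"
      by (rule integral_add)
    then show "cmod (voc_p t - voc_p s) \<le> integral {s..t} (\<lambda>x. \<phi>1 x + \<phi>2 x)"
      unfolding voc_p_def using half[OF 1(3)[OF st] 2(3)[OF st]] by simp
  qed
qed

text \<open>The product rule applies wherever both integrals can be differentiated. The two source
  terms, which enter \<open>voc_u\<close> with opposite signs, here add up: each is G/2 because the
  exponentials are reciprocal.\<close>

lemma voc_p_derivative_AE:
  "AE x in lebesgue. 0 < x \<longrightarrow> (voc_p has_vector_derivative l\<^sup>2 * voc_u x + G x) (at x)"
proof -
  have "AE x in lebesgue. 0 < x \<longrightarrow> ((\<lambda>u. integral {0..u} (\<lambda>t. exp (- l * of_real t) * G t)) has_vector_derivative exp (- l * of_real x) * G x) (at x)"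
    by (rule lebesgue_differentiation_half_line voc_integrable_on)+ simp
  moreover have "AE x in lebesgue. 0 < x \<longrightarrow> ((\<lambda>u. integral {0..u} (\<lambda>t. exp (l * of_real t) * G t)) has_vector_derivative exp (l * of_real x) * G x) (at x)"
    by (rule lebesgue_differentiation_half_line voc_integrable_on)+ simp
  ultimately show ?thesis
  proof eventually_elim
    fix x
    define A where "A y = integral {0..y} (\<lambda>t. exp (- l * of_real t) * G t)" for y
    define B where "B y = integral {0..y} (\<lambda>t. exp (l * of_real t) * G t)" for y
    define E E' where "E = exp (l * of_real x)" and "E' = exp (- l * of_real x)"
    assume A: "0 < x \<longrightarrow> ((\<lambda>u. integral {0..u} (\<lambda>t. exp (- l * of_real t) * G t)) has_vector_derivative exp (- l * of_real x) * G x) (at x)"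
      and B: "0 < x \<longrightarrow> ((\<lambda>u. integral {0..u} (\<lambda>t. exp (l * of_real t) * G t)) has_vector_derivative exp (l * of_real x) * G x) (at x)"
    show "0 < x \<longrightarrow> (voc_p has_vector_derivative l\<^sup>2 * voc_u x + G x) (at x)"
    proof
      assume "0 < x"
      with A B have A': "(A has_vector_derivative E' * G x) (at x)" and B': "(B has_vector_derivative E * G x) (at x)"
        by (simp_all add: A_def[abs_def] B_def[abs_def] E_def E'_def)
      have "((\<lambda>x. \<alpha> + A x) has_vector_derivative 0 + E' * G x) (at x)"
         "((\<lambda>x. \<beta> + B x) has_vector_derivative 0 + E * G x) (at x)"
        by (intro has_vector_derivative_add has_vector_derivative_const A' B')+
      note der = has_vector_derivative_mult[OF has_vector_derivative_exp_mult[of l x UNIV] this(1)]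
         has_vector_derivative_mult[OF has_vector_derivative_exp_mult[of "-l" x UNIV] this(2)]
      have "((\<lambda>x. (exp (l * of_real x) * (\<alpha> + A x) + exp (- l * of_real x) * (\<beta> + B x)) / 2) has_vector_derivative
         ((E * (0 + E' * G x) + l * E * (\<alpha> + A x)) + (E' * (0 + E * G x) + (- l) * E' * (\<beta> + B x))) / 2) (at x)"
        unfolding E_def E'_def
        by (intro has_vector_derivative_divide has_vector_derivative_add der[unfolded E_def E'_def])
      moreover have "E * E' = 1" by (simp add: E_def E'_def exp_minus)
      then have "((E * (0 + E' * G x) + l * E * (\<alpha> + A x)) + (E' * (0 + E * G x) + (- l) * E' * (\<beta> + B x))) / 2
         = l\<^sup>2 * ((E * (\<alpha> + A x) - E' * (\<beta> + B x)) / (2 * l)) + G x"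
        using l by (simp add: field_simps power2_eq_square)
      moreover have "voc_p = (\<lambda>x. (exp (l * of_real x) * (\<alpha> + A x) + exp (- l * of_real x) * (\<beta> + B x)) / 2)"
        and "voc_u x = (E * (\<alpha> + A x) - E' * (\<beta> + B x)) / (2 * l)"
        by (simp_all add: voc_p_def[abs_def] voc_u_def A_def B_def E_def E'_def)
      ultimately show "(voc_p has_vector_derivative l\<^sup>2 * voc_u x + G x) (at x)" by (simp only:)
    qed
  qed
qed

end

section \<open>The fixed point\<close>

text \<open>By \<open>jost_op_representation\<close>,
  \<open>exp (\<mu> * x) * jost_op a (d - \<mu>) g x\<close> has, for d = l and d = - l, exactly the
  form of the corresponding term of \<open>voc_u\<close>, with source
  \<open>exp (\<mu> * t) * g t\<close>. Integrals taken from infinity or from \<open>a\<close> thus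
  become initial value formulas at 0, for which the derivatives are known.\<close>

lemma jost_mode:
  fixes g :: "real \<Rightarrow> complex" and l \<mu> c :: complex
  assumes a: "a \<ge> 0" and g: "integrable lebesgue g" and g0: "\<And>t. t \<le> 0 \<Longrightarrow> g t = 0"
    and l: "l \<noteq> 0" and c: "c = 0 \<or> \<mu> = l \<or> \<mu> = - l"
  obtains u p where
    "\<And>x. 0 \<le> x \<Longrightarrow> u x = exp (\<mu> * of_real x) * (c + (jost_op a (l - \<mu>) g x - jost_op a (- l - \<mu>) g x) / (2 * l))"
    "\<And>x. 0 \<le> x \<Longrightarrow> p x = exp (\<mu> * of_real x) * (\<mu> * c + (jost_op a (l - \<mu>) g x + jost_op a (- l - \<mu>) g x) / 2)"
    "\<And>x. 0 \<le> x \<Longrightarrow> (u has_vector_derivative p x) (at x within {0..})"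
    "\<And>b. \<exists>\<phi>. \<phi> integrable_on {0..b} \<and> (\<forall>x. 0 \<le> \<phi> x) \<and>
       (\<forall>s t. 0 \<le> s \<longrightarrow> s \<le> t \<longrightarrow> t \<le> b \<longrightarrow> cmod (p t - p s) \<le> integral {s..t} \<phi>)"
    "AE x in lebesgue. 0 < x \<longrightarrow> (p has_vector_derivative l\<^sup>2 * u x + exp (\<mu> * of_real x) * g x) (at x)"
proof -
  define G where "G t = exp (\<mu> * of_real t) * g t" for t
  have G: "(\<lambda>t. exp (d * of_real t) * G t) absolutely_integrable_on {0..b}" for d :: complex and b
    using exp_mult_absolutely_integrable[OF a g g0, of 0 b "d + \<mu>"]
    by (simp add: G_def algebra_simps exp_add)
  \<comment> \<open>The free term c is placed in the coefficient whose exponential is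
    \<open>exp (\<mu> * x)\<close>. The factor 2 l undoes the denominator of \<open>voc_u\<close>,
    and in \<open>\<beta>\<close> it enters with a minus sign because that term is subtracted. If
    \<mu> is neither l nor - l, c is 0.\<close>
  define \<alpha> where "\<alpha> = jost_op a (l - \<mu>) g 0 + (if \<mu> = l then 2 * l * c else 0)"
  define \<beta> where "\<beta> = jost_op a (- l - \<mu>) g 0 - (if \<mu> = l then 0 else if \<mu> = - l then 2 * l * c else 0)"
  have J: "exp (\<mu> * of_real x) * jost_op a (d - \<mu>) g x =
      exp (d * of_real x) * (jost_op a (d - \<mu>) g 0 + integral {0..x} (\<lambda>t. exp (- d * of_real t) * G t))"
    if "0 \<le> x" for d x
  proof -
    have "exp (- (d - \<mu>) * of_real t) * g t = exp (- d * of_real t) * G t" for t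
      by (simp add: G_def exp_add[symmetric] algebra_simps)
    then have "jost_op a (d - \<mu>) g x = exp ((d - \<mu>) * of_real x) *
        (jost_op a (d - \<mu>) g 0 + integral {0..x} (\<lambda>t. exp (- d * of_real t) * G t))"
      using jost_op_representation[OF a g g0 that, of "d - \<mu>"] by simp
    moreover have "exp (\<mu> * of_real x) * exp ((d - \<mu>) * of_real x) = exp (d * of_real x)"
      by (simp add: exp_add[symmetric] algebra_simps)
    ultimately show ?thesis by (simp add: mult.assoc[symmetric])
  qed
  have J1: "exp (l * of_real x) * (\<alpha> + integral {0..x} (\<lambda>t. exp (- l * of_real t) * G t))
      = exp (\<mu> * of_real x) * (jost_op a (l - \<mu>) g x + (if \<mu> = l then 2 * l * c else 0))" if "0 \<le> x" for x
    using J[OF that, of l] by (auto simp: \<alpha>_def algebra_simps)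
  have J2: "exp (- l * of_real x) * (\<beta> + integral {0..x} (\<lambda>t. exp (l * of_real t) * G t))
      = exp (\<mu> * of_real x) * (jost_op a (- l - \<mu>) g x - (if \<mu> = l then 0 else if \<mu> = - l then 2 * l * c else 0))" if "0 \<le> x" for x
    using J[OF that, of "- l"] by (auto simp: \<beta>_def algebra_simps)
  show thesis
  proof (rule that)
    show "voc_u l \<alpha> \<beta> G x = exp (\<mu> * of_real x) * (c + (jost_op a (l - \<mu>) g x - jost_op a (- l - \<mu>) g x) / (2 * l))"
      if "0 \<le> x" for x
      unfolding voc_u_def[OF l G] J1[OF that] J2[OF that] using l c
      by (auto simp: field_simps)
    show "voc_p l \<alpha> \<beta> G x = exp (\<mu> * of_real x) * (\<mu> * c + (jost_op a (l - \<mu>) g x + jost_op a (- l - \<mu>) g x) / 2)"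
      if "0 \<le> x" for x
      unfolding voc_p_def[OF l G] J1[OF that] J2[OF that] using l c
      by (auto simp: field_simps)
    show "(voc_u l \<alpha> \<beta> G has_vector_derivative voc_p l \<alpha> \<beta> G x) (at x within {0..})" if "0 \<le> x" for x
      by (rule voc_u_derivative[OF l G that])
    show "\<exists>\<phi>. \<phi> integrable_on {0..b} \<and> (\<forall>x. 0 \<le> \<phi> x) \<and>
       (\<forall>s t. 0 \<le> s \<longrightarrow> s \<le> t \<longrightarrow> t \<le> b \<longrightarrow> cmod (voc_p l \<alpha> \<beta> G t - voc_p l \<alpha> \<beta> G s) \<le> integral {s..t} \<phi>)" for b
      by (rule voc_p_dominated[OF l G, where b = b and \<alpha> = \<alpha> and \<beta> = \<beta>]) blast
    show "AE x in lebesgue. 0 < x \<longrightarrow> (voc_p l \<alpha> \<beta> G has_vector_derivative l\<^sup>2 * voc_u l \<alpha> \<beta> G x + exp (\<mu> * of_real x) * g x) (at x)"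
      using voc_p_derivative_AE[OF l G, of \<alpha> \<beta>] by (simp only: G_def[symmetric])
  qed
qed

text \<open>The fixed point \<open>z\<close> of \<open>jost_map\<close> is \<open>e\<^sup>-\<^sup>\<mu>\<^sup>x F\<close> in standard coordinates; the two \<open>jost_part\<close>s are
  \<open>e\<^sup>-\<^sup>\<mu>\<^sup>x u\<close> and \<open>e\<^sup>-\<^sup>\<mu>\<^sup>x v\<close>, with limits \<open>cu\<close> and \<open>cv\<close>.\<close>

definition jost_source :: "complex \<Rightarrow> (real \<Rightarrow> complex) \<Rightarrow> (real \<Rightarrow> complex \<times> complex) \<Rightarrow> real \<Rightarrow> complex" where
  "jost_source s q z t = (cnj (q t) * fst (z t) + s * q t * snd (z t)) / 2"

definition jost_part :: "real \<Rightarrow> complex \<Rightarrow> complex \<Rightarrow> complex \<Rightarrow> (real \<Rightarrow> complex) \<Rightarrow> real \<Rightarrow> complex" where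
  "jost_part a l \<mu> c g x = c + (jost_op a (l - \<mu>) g x - jost_op a (- l - \<mu>) g x) / (2 * l)"

definition jost_map :: "real \<Rightarrow> (real \<Rightarrow> complex) \<Rightarrow> complex \<Rightarrow> complex \<Rightarrow> complex \<Rightarrow> complex \<Rightarrow>
    (real \<Rightarrow> complex \<times> complex) \<Rightarrow> real \<Rightarrow> complex \<times> complex" where
  "jost_map a q k \<mu> cu cv z x =
     (jost_part a (\<i> * k) \<mu> cu (jost_source 1 q z) x + jost_part a k \<mu> cv (jost_source (- 1) q z) x,
      jost_part a (\<i> * k) \<mu> cu (jost_source 1 q z) x - jost_part a k \<mu> cv (jost_source (- 1) q z) x)"

lemma jost_source_bound:
  assumes "cmod s = 1"
  shows "cmod (jost_source s q z t) \<le> cmod (q t) * norm (z t)"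
proof -
  have "cmod (jost_source s q z t) \<le> (cmod (q t) * cmod (fst (z t)) + cmod (q t) * cmod (snd (z t))) / 2"
    unfolding jost_source_def norm_divide using norm_triangle_ineq[of "cnj (q t) * fst (z t)" "s * q t * snd (z t)"] assms
    by (simp add: norm_mult)
  also have "\<dots> \<le> (cmod (q t) * norm (z t) + cmod (q t) * norm (z t)) / 2"
    using norm_fst_le[of "fst (z t)" "snd (z t)"] norm_snd_le[of "snd (z t)" "fst (z t)"]
    by (intro divide_right_mono add_mono mult_left_mono) simp_all
  finally show ?thesis by simp
qed

lemma jost_source_diff: "jost_source s q z t - jost_source s q z' t = jost_source s q (\<lambda>t. z t - z' t) t"
  by (simp add: jost_source_def diff_divide_distrib[symmetric] algebra_simps)

lemma jost_source_integrable:
  assumes q: "integrable lebesgue q" and z: "continuous_on UNIV z" and B: "\<And>t. norm (z t) \<le> B" and s: "cmod s = 1"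
  shows "integrable lebesgue (jost_source s q z)"
proof (rule Bochner_Integration.integrable_bound)
  show "integrable lebesgue (\<lambda>t. B * cmod (q t))" using q by simp
  have "(\<lambda>t. fst (z t)) \<in> borel_measurable borel" "(\<lambda>t. snd (z t)) \<in> borel_measurable borel"
    using z by (intro borel_measurable_continuous_onI continuous_intros; simp)+
  then have z1: "(\<lambda>t. fst (z t)) \<in> borel_measurable lebesgue" and z2: "(\<lambda>t. snd (z t)) \<in> borel_measurable lebesgue"
    by (auto intro!: measurable_completion)
  have q': "q \<in> borel_measurable lebesgue" using q by auto
  have "(\<lambda>t. cnj (q t)) \<in> borel_measurable lebesgue"
    by (rule borel_measurable_continuous_on[OF _ q', of cnj]) (intro continuous_intros)
  then show "jost_source s q z \<in> borel_measurable lebesgue"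
    unfolding jost_source_def[abs_def] using z1 z2 q' by measurable
  show "AE t in lebesgue. cmod (jost_source s q z t) \<le> norm (B * cmod (q t))"
  proof (rule AE_I2)
    fix t
    have "cmod (jost_source s q z t) \<le> cmod (q t) * norm (z t)" by (rule jost_source_bound[OF s])
    also have "\<dots> \<le> cmod (q t) * B" by (intro mult_left_mono B) simp
    finally show "cmod (jost_source s q z t) \<le> norm (B * cmod (q t))"
      by (simp add: mult.commute)
  qed
qed

text \<open>The free term c cancels. Both shifted exponents l - \<mu> and - l - \<mu> have modulus
  at most |l| + |\<mu>|, so one M majorizes both kernels; two contributions of \<eta> over |2 l|
  give the bound.\<close>

lemma jost_part_diff_bound:
  assumes a: "a \<ge> 0" and x: "0 \<le> x" and l: "l \<noteq> 0" and M: "M \<ge> exp ((cmod l + cmod \<mu>) * a)"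
    and g: "integrable lebesgue g" "integrable lebesgue h" "\<And>t. t \<le> 0 \<Longrightarrow> g t = 0" "\<And>t. t \<le> 0 \<Longrightarrow> h t = 0"
    and r: "integrable lebesgue r" "\<And>t. cmod (g t - h t) \<le> r t"
    and bound: "(LINT t|lebesgue. kernel_bound a M x t * r t) \<le> \<eta>"
  shows "cmod (jost_part a l \<mu> c g x - jost_part a l \<mu> c h x) \<le> \<eta> / cmod l"
proof -
  have J: "cmod (jost_op a d g x - jost_op a d h x) \<le> \<eta>" if d: "cmod d \<le> cmod l + cmod \<mu>" for d
  proof -
    have "cmod d * a \<le> (cmod l + cmod \<mu>) * a" using d a by (intro mult_right_mono)
    then have M': "exp (cmod d * a) \<le> M" using M order_trans exp_le_cancel_iff by blast
    show ?thesis
      using jost_op_diff[OF a x g, of d] jost_op_bound[OF a _ _ x M' r(2) r(1)] g bound by auto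
  qed
  have "jost_part a l \<mu> c g x - jost_part a l \<mu> c h x =
      ((jost_op a (l - \<mu>) g x - jost_op a (l - \<mu>) h x) - (jost_op a (- l - \<mu>) g x - jost_op a (- l - \<mu>) h x)) / (2 * l)"
    by (simp add: jost_part_def diff_divide_distrib[symmetric])
  also have "cmod \<dots> \<le> (\<eta> + \<eta>) / cmod (2 * l)"
    unfolding norm_divide
  proof (rule divide_right_mono[OF order_trans[OF norm_triangle_ineq4 add_mono]])
    show "cmod (jost_op a (l - \<mu>) g x - jost_op a (l - \<mu>) h x) \<le> \<eta>"
      by (rule J[OF norm_triangle_ineq4])
    show "cmod (jost_op a (- l - \<mu>) g x - jost_op a (- l - \<mu>) h x) \<le> \<eta>"
      using J[of "- l - \<mu>"] norm_triangle_ineq4[of "- l" \<mu>] by simp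
  qed simp
  also have "\<dots> = \<eta> / cmod l" using l by (simp add: norm_mult field_simps)
  finally show ?thesis .
qed

lemma norm_sum_diff_pair_le: "norm (U + V, U - V) \<le> 2 * (norm U + norm V)"
proof -
  have "norm (U + V, U - V) \<le> norm (U + V) + norm (U - V)" by (rule norm_Pair_le)
  also have "\<dots> \<le> (norm U + norm V) + (norm U + norm V)"
    by (intro add_mono norm_triangle_ineq norm_triangle_ineq4)
  finally show ?thesis by simp
qed

lemma continuous_on_jost_part:
  assumes "a \<ge> 0" "integrable lebesgue g" "\<And>t. t \<le> 0 \<Longrightarrow> g t = 0"
  shows "continuous_on {0..} (jost_part a l \<mu> c g)"
proof -
  have "continuous_on {0..} (jost_op a d g)" for d
    by (rule continuous_on_jost_op) (use assms in auto)
  then show ?thesis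
    unfolding jost_part_def[abs_def] divide_inverse by (intro continuous_intros)
qed

text \<open>The unknown is rescaled to Y = z / w, so that the weighted norm of z is the plain
  supremum norm of Y and Banach's theorem applies in the space of bounded continuous functions. As w
  lies between 1 and W, boundedness of Y and of z is the same.\<close>

lemma jost_fixed_point:
  fixes q :: "real \<Rightarrow> complex" and k \<mu> cu cv :: complex
  assumes q: "integrable lebesgue q" and q0: "\<And>t. t \<le> 0 \<Longrightarrow> q t = 0" and k: "k \<noteq> 0"
  obtains a z B where "a \<ge> 0" "continuous_on UNIV z" "\<And>t. norm (z t) \<le> B"
    "\<And>x. 0 \<le> x \<Longrightarrow> z x = jost_map a q k \<mu> cu cv z x"
proof -
  \<comment> \<open>Each component u, v contributes \<open>d * w / 8\<close> after division by |l| =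
    |k|. Two components and the factor 2 of \<open>norm_sum_diff_pair_le\<close> yield the
    contraction constant 1/2.\<close>
  have k8: "cmod k / 8 > 0" using k by simp
  obtain a where a: "a \<ge> 0" and aw: "\<And>M. M \<ge> 0 \<Longrightarrow> \<exists>w W. continuous_on UNIV w \<and> (\<forall>x. 1 \<le> w x \<and> w x \<le> W) \<and>
     (\<forall>x. (LINT t|lebesgue. kernel_bound a M x t * (cmod (q t) * w t)) \<le> cmod k / 8 * w x)"
    using exists_kernel_weight[of "\<lambda>t. cmod (q t)", OF integrable_norm[OF q] norm_ge_zero k8] by blast
  define M where "M = exp ((cmod k + cmod \<mu>) * a)"
  have "M \<ge> 0" by (simp add: M_def)
  then obtain w W where w: "continuous_on UNIV w" "\<And>x. 1 \<le> w x" "\<And>x. w x \<le> W"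
     and wk: "\<And>x. (LINT t|lebesgue. kernel_bound a M x t * (cmod (q t) * w t)) \<le> cmod k / 8 * w x"
    using aw[of M] by blast
  have wpos: "0 < w x" for x using w(2)[of x] by linarith
  have W0: "0 \<le> W" using wpos[of 0] w(3)[of 0] by linarith
  have qw: "integrable lebesgue (\<lambda>t. cmod (q t) * w t)"
  proof (rule Bochner_Integration.integrable_bound)
    show "integrable lebesgue (\<lambda>t. W * cmod (q t))" using q by simp
    have "w \<in> borel_measurable lebesgue"
      using w(1) by (intro measurable_completion) (simp add: borel_measurable_continuous_onI)
    then show "(\<lambda>t. cmod (q t) * w t) \<in> borel_measurable lebesgue"
      using q by (intro borel_measurable_times borel_measurable_norm) auto
    show "AE t in lebesgue. norm (cmod (q t) * w t) \<le> norm (W * cmod (q t))"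
      using w(3) wpos W0 by (intro AE_I2) (simp add: abs_mult less_imp_le mult.commute mult_right_mono)
  qed
  let ?T = "jost_map a q k \<mu> cu cv"
  define Z where "Z Y t = w t *\<^sub>R Y t" for Y :: "real \<Rightarrow> complex \<times> complex" and t
  \<comment> \<open>This is the map conjugated by the weight. Using \<open>max 0 x\<close> extends
    each image constantly to the left of 0, giving continuous functions on the whole line as the
    function space requires.\<close>
  define S where "S Y x = (1 / w (max 0 x)) *\<^sub>R ?T (Z Y) (max 0 x)" for Y x
  have src0: "jost_source s q z t = 0" if "t \<le> 0" for s z t
    using q0[OF that] by (simp add: jost_source_def)
  have Zc: "continuous_on UNIV (Z Y)" if "continuous_on UNIV Y" for Y
    unfolding Z_def using w(1) that by (intro continuous_intros)
  have Zb: "norm (Z Y t) \<le> W * B" if "\<And>t. norm (Y t) \<le> B" for Y B t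
    unfolding Z_def norm_scaleR using w(3)[of t] wpos[of t] that[of t] W0 by (intro mult_mono) auto
  have si: "integrable lebesgue (jost_source s q (Z Y))" if "cmod s = 1" "continuous_on UNIV Y" "\<And>t. norm (Y t) \<le> B" for s Y B
    by (rule jost_source_integrable[OF q Zc[OF that(2)] Zb[OF that(3)] that(1)])
  have contr: "norm (S Y x - S Y' x) \<le> 1 / 2 * d"
    if Y: "continuous_on UNIV Y" "\<And>t. norm (Y t) \<le> B" "continuous_on UNIV Y'" "\<And>t. norm (Y' t) \<le> B'"
      and d: "\<And>t. norm (Y t - Y' t) \<le> d" for Y Y' B B' d x
  proof -
    define m where "m = max 0 x"
    have m: "0 \<le> m" by (simp add: m_def)
    define P where "P l c s y = jost_part a l \<mu> c (jost_source s q (Z y)) m" for l c s y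
    have part: "cmod (P l c s Y - P l c s Y') \<le> d * w m / 8" if ls: "cmod l = cmod k" "cmod s = 1" for l c s
    proof -
      have "cmod (P l c s Y - P l c s Y') \<le> (d * (cmod k / 8 * w m)) / cmod l"
        unfolding P_def
      proof (rule jost_part_diff_bound[OF a m])
        show "exp ((cmod l + cmod \<mu>) * a) \<le> M" using ls by (simp add: M_def)
        show "integrable lebesgue (\<lambda>t. d * (cmod (q t) * w t))" using qw by simp
        fix t
        have "cmod (jost_source s q (Z Y) t - jost_source s q (Z Y') t) \<le> cmod (q t) * norm (Z Y t - Z Y' t)"
          unfolding jost_source_diff by (rule jost_source_bound[OF ls(2)])
        also have "\<dots> = cmod (q t) * (w t * norm (Y t - Y' t))"
          using wpos[of t] by (simp add: Z_def scaleR_diff_right[symmetric])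
        also have "\<dots> \<le> cmod (q t) * (w t * d)"
          using wpos[of t] d[of t] by (intro mult_left_mono) auto
        finally show "cmod (jost_source s q (Z Y) t - jost_source s q (Z Y') t) \<le> d * (cmod (q t) * w t)"
          by (simp add: mult_ac)
      next
        have "0 \<le> d" using d[of 0] norm_ge_zero order_trans by blast
        have "(LINT t|lebesgue. kernel_bound a M m t * (d * (cmod (q t) * w t)))
           = d * (LINT t|lebesgue. kernel_bound a M m t * (cmod (q t) * w t))"
          by (subst integral_mult_right_zero[symmetric]) (simp add: mult_ac)
        also have "\<dots> \<le> d * (cmod k / 8 * w m)" using wk \<open>0 \<le> d\<close> by (rule mult_left_mono)
        finally show "(LINT t|lebesgue. kernel_bound a M m t * (d * (cmod (q t) * w t))) \<le> d * (cmod k / 8 * w m)" .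
      qed (use ls k src0 si[OF ls(2) Y(1,2)] si[OF ls(2) Y(3,4)] in auto)
      then show ?thesis using ls k by simp
    qed
    have "?T (Z Y) m - ?T (Z Y') m =
       ((P (\<i> * k) cu 1 Y - P (\<i> * k) cu 1 Y') + (P k cv (- 1) Y - P k cv (- 1) Y'),
        (P (\<i> * k) cu 1 Y - P (\<i> * k) cu 1 Y') - (P k cv (- 1) Y - P k cv (- 1) Y'))"
      by (simp add: jost_map_def P_def)
    also have "norm \<dots> \<le> 2 * (cmod (P (\<i> * k) cu 1 Y - P (\<i> * k) cu 1 Y') + cmod (P k cv (- 1) Y - P k cv (- 1) Y'))"
      by (rule norm_sum_diff_pair_le)
    also have "\<dots> \<le> 2 * (d * w m / 8 + d * w m / 8)"
      by (intro mult_left_mono add_mono part) (auto simp: norm_mult)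
    finally have "norm (?T (Z Y) m - ?T (Z Y') m) \<le> 1 / 2 * d * w m" by simp
    then show ?thesis
      unfolding S_def m_def[symmetric] scaleR_diff_right[symmetric] norm_scaleR
      using wpos[of m] by (simp add: field_simps)
  qed
  have S: "S Y \<in> bcontfun" if Y: "continuous_on UNIV Y" "\<And>t. norm (Y t) \<le> B" for Y B
  proof -
    have "continuous_on {0..} (?T (Z Y))"
      unfolding jost_map_def[abs_def]
      by (intro continuous_intros continuous_on_jost_part a si[OF _ Y] src0) auto
    then have "continuous_on UNIV (\<lambda>x. ?T (Z Y) (max 0 x))"
      by (rule continuous_on_compose2) (auto intro!: continuous_intros)
    moreover have "continuous_on UNIV (\<lambda>x. w (max 0 x))"
      by (rule continuous_on_compose2[OF w(1)]) (auto intro!: continuous_intros)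
    ultimately have "continuous_on UNIV (S Y)"
      unfolding S_def using wpos by (intro continuous_intros) (auto simp: less_imp_neq[symmetric])
    \<comment> \<open>The image of the zero function is the constant free term divided by w \<ge> 1;
      the contraction estimate against zero bounds the rest.\<close>
    moreover have "norm (S Y x) \<le> norm (cu + cv, cu - cv) + 1 / 2 * B" for x
    proof -
      have "?T (Z (\<lambda>_. 0)) (max 0 x) = (cu + cv, cu - cv)"
        by (simp add: jost_map_def jost_part_def jost_op_def jost_source_def Z_def)
      then have "norm (S (\<lambda>_. 0) x) = norm (cu + cv, cu - cv) / w (max 0 x)"
        using wpos[of "max 0 x"] unfolding S_def by (simp only: norm_scaleR) simp
      also have "\<dots> \<le> norm (cu + cv, cu - cv) / 1"
        by (intro divide_left_mono) (use w(2) wpos in auto)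
      finally have "norm (S (\<lambda>_. 0) x) \<le> norm (cu + cv, cu - cv)" by simp
      moreover have "norm (S Y x - S (\<lambda>_. 0) x) \<le> 1 / 2 * B"
        by (rule contr[OF Y, where B' = 0]) (use Y(2) in auto)
      ultimately show ?thesis
        using norm_triangle_ineq[of "S (\<lambda>_. 0) x" "S Y x - S (\<lambda>_. 0) x"] by simp
    qed
    then have "bounded (range (S Y))" unfolding bounded_iff by blast
    ultimately show ?thesis by (simp add: bcontfun_def)
  qed
  define ST :: "(real \<Rightarrow>\<^sub>C (complex \<times> complex)) \<Rightarrow> (real \<Rightarrow>\<^sub>C (complex \<times> complex))"
    where "ST Y = Bcontfun (S (apply_bcontfun Y))" for Y
  have Yb: "\<exists>B. \<forall>t. norm (apply_bcontfun Y t) \<le> B" for Y :: "real \<Rightarrow>\<^sub>C (complex \<times> complex)"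
    using bounded_apply_bcontfun[of Y] by (auto simp: bounded_iff)
  have ST: "apply_bcontfun (ST Y) = S (apply_bcontfun Y)" for Y
  proof -
    obtain B where "\<forall>t. norm (apply_bcontfun Y t) \<le> B" using Yb by blast
    then have "S (apply_bcontfun Y) \<in> bcontfun" using S[of "apply_bcontfun Y" B] by simp
    then show ?thesis unfolding ST_def by (rule Bcontfun_inverse)
  qed
  have "dist (ST Y) (ST Y') \<le> 1 / 2 * dist Y Y'" for Y Y'
  proof (rule dist_bound)
    fix x
    obtain B B' where B: "\<forall>t. norm (apply_bcontfun Y t) \<le> B" "\<forall>t. norm (apply_bcontfun Y' t) \<le> B'" using Yb by metis
    show "dist (apply_bcontfun (ST Y) x) (apply_bcontfun (ST Y') x) \<le> 1 / 2 * dist Y Y'"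
      unfolding ST dist_norm
      by (rule contr[where B = B and B' = B']) (use B dist_bounded[of Y _ Y'] in \<open>auto simp: dist_norm[symmetric]\<close>)
  qed
  then have "\<exists>!Y. ST Y = Y" by (intro banach_fix_type[of "1/2"]) auto
  then obtain Y where Y: "ST Y = Y" by blast
  obtain B where B: "\<And>t. norm (apply_bcontfun Y t) \<le> B" using Yb by blast
  show thesis
  proof (rule that[OF a])
    show "continuous_on UNIV (Z (apply_bcontfun Y))" by (rule Zc) simp
    show "norm (Z (apply_bcontfun Y) t) \<le> W * B" for t by (rule Zb[OF B])
    fix x :: real assume x: "0 \<le> x"
    have "apply_bcontfun Y x = S (apply_bcontfun Y) x" using ST[of Y] Y by simp
    also have "\<dots> = (1 / w x) *\<^sub>R ?T (Z (apply_bcontfun Y)) x" using x by (simp add: S_def max_def)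
    finally show "Z (apply_bcontfun Y) x = ?T (Z (apply_bcontfun Y)) x"
      using wpos[of x] by (simp add: Z_def[of _ x])
  qed
qed

section \<open>Jost solutions\<close>

definition vec2 :: "complex \<times> complex \<Rightarrow> complex ^ 2" where
  "vec2 p = vector [fst p, snd p]"

lemma vec2_nth [simp]: "vec2 p $ 1 = fst p" "vec2 p $ 2 = snd p"
  by (simp_all add: vec2_def vector_2)

lemma vec2_diff: "vec2 p - vec2 p' = vec2 (p - p')"
  by (simp add: vec_eq_iff forall_2)

lemma bounded_linear_vec2: "bounded_linear vec2"
  by (intro linear_conv_bounded_linear[THEN iffD1] linearI) (simp_all add: vec_eq_iff forall_2)

lemma norm_vec2_le: "norm (vec2 p) \<le> cmod (fst p) + cmod (snd p)"
proof -
  have "norm (vec2 p) \<le> (\<Sum>i\<in>UNIV. norm (vec2 p $ i))"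
    unfolding norm_vec_def by (rule L2_set_le_sum) simp
  then show ?thesis by (simp add: sum_2)
qed

lemma small_o_expI:
  assumes R: "\<And>x. 0 \<le> x \<Longrightarrow> R x = vec2 (exp (\<mu> * of_real x) * A x, exp (\<mu> * of_real x) * B x)"
    and A: "(A \<longlongrightarrow> 0) at_top" and B: "(B \<longlongrightarrow> 0) at_top"
  shows "small_o_exp \<mu> R"
  unfolding small_o_exp_def
proof (rule Lim_null_comparison)
  show "((\<lambda>x. cmod (A x) + cmod (B x)) \<longlongrightarrow> 0) at_top"
    using tendsto_add[OF tendsto_norm_zero[OF A] tendsto_norm_zero[OF B]] by simp
  show "eventually (\<lambda>x. norm (norm (R x) / cmod (exp (\<mu> * of_real x))) \<le> cmod (A x) + cmod (B x)) at_top"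
    using eventually_ge_at_top[of 0]
  proof eventually_elim
    fix x :: real assume "0 \<le> x"
    define e where "e = exp (\<mu> * complex_of_real x)"
    have "norm (R x) \<le> cmod e * (cmod (A x) + cmod (B x))"
      using norm_vec2_le[of "(e * A x, e * B x)"] R[OF \<open>0 \<le> x\<close>]
      by (simp add: e_def[symmetric] norm_mult distrib_left del: norm_exp_eq_Re)
    moreover have "cmod e > 0" by (simp add: e_def)
    ultimately show "norm (norm (R x) / cmod (exp (\<mu> * of_real x))) \<le> cmod (A x) + cmod (B x)"
      unfolding e_def[symmetric] by (simp add: divide_le_eq mult.commute)
  qed
qed

text \<open>Every x \<ge> 0, including 0 itself, is approached from the right within
  \<open>{0..}\<close>, so the one-sided derivative is unique.\<close>

lemma half_line_deriv_eq:
  assumes "(F has_vector_derivative D) (at x within {0..})" "0 \<le> x"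
  shows "half_line_deriv F x = D"
  unfolding half_line_deriv_def
proof (rule vector_derivative_within[OF _ assms(1)])
  have "at_right x \<le> at x within {0..}" using assms(2) by (intro at_le) auto
  then show "at x within {0..} \<noteq> bot"
    using trivial_limit_at_right_real[of x] bot.extremum_uniqueI by metis
qed

lemma locally_absolutely_continuous_on_half_lineI:
  assumes "\<And>b. absolutely_continuous_on {0..b} F"
  shows "locally_absolutely_continuous_on {0..} F"
  unfolding locally_absolutely_continuous_on_def
proof (intro allI impI)
  fix a b :: real assume ab: "{a..b} \<subseteq> {0..}"
  show "absolutely_continuous_on {a..b} F"
  proof (cases "a \<le> b")
    case True
    then have "0 \<le> a" using ab by auto
    then have "{a..b} \<subseteq> {0..b}" by auto
    with assms[of b] show ?thesis
      unfolding absolutely_continuous_on_def by (meson subsetD)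
  qed (simp add: absolutely_continuous_on_empty)
qed

lemma absolutely_continuous_on_C1:
  fixes F :: "real \<Rightarrow> 'a::euclidean_space"
  assumes F: "\<And>x. 0 \<le> x \<Longrightarrow> (F has_vector_derivative H x) (at x within {0..})"
    and H: "continuous_on {0..} H"
  shows "absolutely_continuous_on {0..b} F"
proof (rule absolutely_continuous_onI_integral)
  have Hc: "continuous_on {s..t} H" if "0 \<le> s" for s t
    using H by (rule continuous_on_subset) (use that in auto)
  show "(\<lambda>x. norm (H x)) integrable_on {0..b}"
    by (intro integrable_continuous_real continuous_on_norm Hc) simp
  fix s t assume st: "0 \<le> s" "s \<le> t" "t \<le> b"
  have "(H has_integral (F t - F s)) {s..t}"
  proof (rule fundamental_theorem_of_calculus[OF st(2)])
    fix x assume "x \<in> {s..t}"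
    then show "(F has_vector_derivative H x) (at x within {s..t})"
      using F[of x] st by (intro has_vector_derivative_within_subset[where S = "{0..}" and T = "{s..t}"]) auto
  qed
  then have "F t - F s = integral {s..t} H" by (simp add: integral_unique)
  also have "norm \<dots> \<le> integral {s..t} (\<lambda>x. norm (H x))"
    by (intro Henstock_Kurzweil_Integration.integral_norm_bound_integral integrable_continuous_real continuous_on_norm Hc st) simp
  finally show "dist (F s) (F t) \<le> integral {s..t} (\<lambda>x. norm (H x))"
    by (simp add: dist_norm norm_minus_commute)
qed simp

text \<open>Treats all four solutions at once: \<open>vec2 (cu + cv, cu - cv)\<close> is cu times
  \<open>e_plus\<close> plus cv times \<open>e_minus\<close>. The conditions on cu and cv state that
  a nonzero coefficient belongs to a mode in which \<open>exp (\<mu> * x)\<close> solves the free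
  equation.\<close>

lemma jost_solution:
  fixes q :: "real \<Rightarrow> complex" and k \<mu> cu cv :: complex
  assumes q: "integrable (lebesgue_on {0<..}) q" and k: "k \<noteq> 0"
    and cu: "cu = 0 \<or> \<mu> = \<i> * k \<or> \<mu> = - (\<i> * k)" and cv: "cv = 0 \<or> \<mu> = k \<or> \<mu> = - k"
  obtains F where "is_solution q k F"
    "small_o_exp \<mu> (\<lambda>x. F x - exp (\<mu> * of_real x) *s vec2 (cu + cv, cu - cv))"
    "small_o_exp \<mu> (\<lambda>x. half_line_deriv F x - (\<mu> * exp (\<mu> * of_real x)) *s vec2 (cu + cv, cu - cv))"
proof -
  \<comment> \<open>Integrability is given on the half line only. Extension by zero lets all
    operators integrate over the whole line.\<close>
  define q0 where "q0 t = (if 0 < t then q t else 0)" for t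
  have q0z: "q0 t = 0" if "t \<le> 0" for t using that by (simp add: q0_def)
  have q0: "integrable lebesgue q0"
  proof -
    have "integrable lebesgue (\<lambda>t. indicator {0<..} t *\<^sub>R q t)"
      using q by (subst integrable_restrict_space[symmetric]) simp_all
    also have "(\<lambda>t. indicator {0<..} t *\<^sub>R q t) = q0" by (auto simp: q0_def indicator_def)
    finally show ?thesis .
  qed
  obtain a z B where a: "a \<ge> 0" and zc: "continuous_on UNIV z" and zB: "\<And>t. norm (z t) \<le> B"
    and z: "\<And>x. 0 \<le> x \<Longrightarrow> z x = jost_map a q0 k \<mu> cu cv z x"
    using jost_fixed_point[OF q0 q0z k] by blast
  let ?gu = "jost_source 1 q0 z" and ?gv = "jost_source (- 1) q0 z"
  have gu: "integrable lebesgue ?gu" and gv: "integrable lebesgue ?gv"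
    by (rule jost_source_integrable[OF q0 zc zB], simp)+
  have gu0: "?gu t = 0" and gv0: "?gv t = 0" if "t \<le> 0" for t
    using q0z[OF that] by (simp_all add: jost_source_def)
  have ik: "\<i> * k \<noteq> 0" using k by simp
  \<comment> \<open>\<open>eU\<close>, \<open>eV\<close> are the remainders of u, v relative to
    \<open>exp (\<mu> * x)\<close>, and \<open>dU\<close>, \<open>dV\<close> those of their
    derivatives. All are combinations of the same operators, so one limit lemma serves both
    asymptotics.\<close>
  define eU where "eU x = (jost_op a (\<i> * k - \<mu>) ?gu x - jost_op a (- (\<i> * k) - \<mu>) ?gu x) / (2 * (\<i> * k))" for x
  define eV where "eV x = (jost_op a (k - \<mu>) ?gv x - jost_op a (- k - \<mu>) ?gv x) / (2 * k)" for x
  define dU where "dU x = (jost_op a (\<i> * k - \<mu>) ?gu x + jost_op a (- (\<i> * k) - \<mu>) ?gu x) / 2" for x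
  define dV where "dV x = (jost_op a (k - \<mu>) ?gv x + jost_op a (- k - \<mu>) ?gv x) / 2" for x
  have Ju: "(jost_op a d ?gu \<longlongrightarrow> 0) at_top" and Jv: "(jost_op a d ?gv \<longlongrightarrow> 0) at_top" for d
    using jost_op_tendsto_0[OF a gu gu0] jost_op_tendsto_0[OF a gv gv0] by blast+
  have tendsto: "(eU \<longlongrightarrow> 0) at_top" "(eV \<longlongrightarrow> 0) at_top" "(dU \<longlongrightarrow> 0) at_top" "(dV \<longlongrightarrow> 0) at_top"
    unfolding eU_def[abs_def] eV_def[abs_def] dU_def[abs_def] dV_def[abs_def] divide_inverse
    by (intro tendsto_mult_left_zero tendsto_diff[where a = 0 and b = 0, simplified] tendsto_add_zero Ju Jv)+
  have cJ: "continuous_on {0..} (jost_op a d ?gu)" "continuous_on {0..} (jost_op a d ?gv)" for d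
    using continuous_on_jost_op[OF a gu gu0] continuous_on_jost_op[OF a gv gv0] by blast+
  obtain u p where u: "\<And>x. 0 \<le> x \<Longrightarrow> u x = exp (\<mu> * of_real x) * (cu + eU x)"
    and p: "\<And>x. 0 \<le> x \<Longrightarrow> p x = exp (\<mu> * of_real x) * (\<mu> * cu + dU x)"
    and up: "\<And>x. 0 \<le> x \<Longrightarrow> (u has_vector_derivative p x) (at x within {0..})"
    and pd: "\<And>b. \<exists>\<phi>. \<phi> integrable_on {0..b} \<and> (\<forall>x. 0 \<le> \<phi> x) \<and>
       (\<forall>s t. 0 \<le> s \<longrightarrow> s \<le> t \<longrightarrow> t \<le> b \<longrightarrow> cmod (p t - p s) \<le> integral {s..t} \<phi>)"
    and pAE: "AE x in lebesgue. 0 < x \<longrightarrow> (p has_vector_derivative (\<i> * k)\<^sup>2 * u x + exp (\<mu> * of_real x) * ?gu x) (at x)"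
    by (rule jost_mode[OF a gu gu0 ik cu, folded eU_def dU_def], assumption) (rule that; assumption)
  obtain v r where v: "\<And>x. 0 \<le> x \<Longrightarrow> v x = exp (\<mu> * of_real x) * (cv + eV x)"
    and r: "\<And>x. 0 \<le> x \<Longrightarrow> r x = exp (\<mu> * of_real x) * (\<mu> * cv + dV x)"
    and vr: "\<And>x. 0 \<le> x \<Longrightarrow> (v has_vector_derivative r x) (at x within {0..})"
    and rd: "\<And>b. \<exists>\<phi>. \<phi> integrable_on {0..b} \<and> (\<forall>x. 0 \<le> \<phi> x) \<and>
       (\<forall>s t. 0 \<le> s \<longrightarrow> s \<le> t \<longrightarrow> t \<le> b \<longrightarrow> cmod (r t - r s) \<le> integral {s..t} \<phi>)"
    and rAE: "AE x in lebesgue. 0 < x \<longrightarrow> (r has_vector_derivative k\<^sup>2 * v x + exp (\<mu> * of_real x) * ?gv x) (at x)"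
    by (rule jost_mode[OF a gv gv0 k cv, folded eV_def dV_def], assumption) (rule that; assumption)
  define F where "F x = vec2 (u x + v x, u x - v x)" for x
  define H where "H x = vec2 (p x + r x, p x - r x)" for x
  have vec2_deriv: "((\<lambda>x. vec2 (f x + g x, f x - g x)) has_vector_derivative vec2 (f' + g', f' - g')) (at x within S)"
    if "(f has_vector_derivative f') (at x within S)" "(g has_vector_derivative g') (at x within S)" for f g f' g' x S
    by (intro bounded_linear.has_vector_derivative[OF bounded_linear_vec2] has_vector_derivative_Pair
        has_vector_derivative_add has_vector_derivative_diff that)
  have FH: "(F has_vector_derivative H x) (at x within {0..})" if "0 \<le> x" for x
    unfolding F_def[abs_def] H_def by (rule vec2_deriv[OF up[OF that] vr[OF that]])
  have FD: "half_line_deriv F x = H x" if "0 \<le> x" for x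
    by (rule half_line_deriv_eq[OF FH[OF that] that])
  have pc: "continuous_on {0..} p"
  proof -
    have "continuous_on {0..} (\<lambda>x. exp (\<mu> * of_real x) * (\<mu> * cu + dU x))"
      unfolding dU_def divide_inverse by (intro continuous_intros cJ)
    then show ?thesis by (rule continuous_on_eq) (simp add: p)
  qed
  have rc: "continuous_on {0..} r"
  proof -
    have "continuous_on {0..} (\<lambda>x. exp (\<mu> * of_real x) * (\<mu> * cv + dV x))"
      unfolding dV_def divide_inverse by (intro continuous_intros cJ)
    then show ?thesis by (rule continuous_on_eq) (simp add: r)
  qed
  have Hc: "continuous_on {0..} H"
    unfolding H_def[abs_def]
    by (intro bounded_linear.continuous_on[OF bounded_linear_vec2] continuous_intros pc rc)
  have F_ac: "absolutely_continuous_on {0..b} F" for b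
    by (rule absolutely_continuous_on_C1[OF FH Hc])
  have H_ac: "absolutely_continuous_on {0..b} (half_line_deriv F)" for b
  proof -
    obtain \<phi> where \<phi>: "\<phi> integrable_on {0..b}" "\<forall>x. 0 \<le> \<phi> x"
       "\<And>s t. 0 \<le> s \<Longrightarrow> s \<le> t \<Longrightarrow> t \<le> b \<Longrightarrow> cmod (p t - p s) \<le> integral {s..t} \<phi>"
      using pd[of b] by blast
    obtain \<psi> where \<psi>: "\<psi> integrable_on {0..b}" "\<forall>x. 0 \<le> \<psi> x"
       "\<And>s t. 0 \<le> s \<Longrightarrow> s \<le> t \<Longrightarrow> t \<le> b \<Longrightarrow> cmod (r t - r s) \<le> integral {s..t} \<psi>"
      using rd[of b] by blast
    show ?thesis
    proof (rule absolutely_continuous_onI_integral)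
      show "(\<lambda>x. 2 * (\<phi> x + \<psi> x)) integrable_on {0..b}"
        using \<phi>(1) \<psi>(1) by (intro integrable_on_mult_right integrable_add)
      show "0 \<le> 2 * (\<phi> x + \<psi> x)" for x using \<phi>(2) \<psi>(2) by simp
      fix s t assume st: "0 \<le> s" "s \<le> t" "t \<le> b"
      have "half_line_deriv F t - half_line_deriv F s = vec2 ((p t - p s) + (r t - r s), (p t - p s) - (r t - r s))"
        using st by (simp add: FD H_def vec2_diff algebra_simps)
      then have "dist (half_line_deriv F s) (half_line_deriv F t)
          = norm (vec2 ((p t - p s) + (r t - r s), (p t - p s) - (r t - r s)))"
        by (simp only: dist_norm norm_minus_commute[of "half_line_deriv F s"])
      also have "\<dots> \<le> cmod ((p t - p s) + (r t - r s)) + cmod ((p t - p s) - (r t - r s))"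
        using norm_vec2_le[of "((p t - p s) + (r t - r s), (p t - p s) - (r t - r s))"] by simp
      also have "\<dots> \<le> (cmod (p t - p s) + cmod (r t - r s)) + (cmod (p t - p s) + cmod (r t - r s))"
        by (intro add_mono norm_triangle_ineq norm_triangle_ineq4)
      also have "\<dots> \<le> 2 * (integral {s..t} \<phi> + integral {s..t} \<psi>)"
        using \<phi>(3)[OF st] \<psi>(3)[OF st] by simp
      also have "\<dots> = integral {s..t} (\<lambda>x. 2 * (\<phi> x + \<psi> x))"
      proof -
        have "\<phi> integrable_on {s..t}" "\<psi> integrable_on {s..t}"
          by (rule integrable_subinterval_real[OF \<phi>(1)] integrable_subinterval_real[OF \<psi>(1)]; use st in auto)+
        then show ?thesis by (simp add: integral_add)
      qed
      finally show "dist (half_line_deriv F s) (half_line_deriv F t) \<le> integral {s..t} (\<lambda>x. 2 * (\<phi> x + \<psi> x))" .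
    qed
  qed
  have ode: "half_line_deriv F differentiable (at x within {0..}) \<and>
        - (eps_mat *v half_line_deriv (half_line_deriv F) x) + Q_mat q x *v F x = k\<^sup>2 *s F x"
    if x: "0 < x" and p': "(p has_vector_derivative (\<i> * k)\<^sup>2 * u x + exp (\<mu> * of_real x) * ?gu x) (at x)"
      and r': "(r has_vector_derivative k\<^sup>2 * v x + exp (\<mu> * of_real x) * ?gv x) (at x)" for x
  proof -
    define p1 r1 where "p1 = (\<i> * k)\<^sup>2 * u x + exp (\<mu> * of_real x) * ?gu x"
      and "r1 = k\<^sup>2 * v x + exp (\<mu> * of_real x) * ?gv x"
    have "(H has_vector_derivative vec2 (p1 + r1, p1 - r1)) (at x)"
      unfolding H_def[abs_def] p1_def r1_def by (rule vec2_deriv[OF p' r'])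
    \<comment> \<open>\<open>half_line_deriv F\<close> is identified with H only for nonnegative
      arguments; the open set \<open>{0<..}\<close> around x > 0 suffices for the two-sided
      derivative.\<close>
    then have "(half_line_deriv F has_vector_derivative vec2 (p1 + r1, p1 - r1)) (at x)"
      by (rule has_vector_derivative_transform_within_open[where S = "{0<..}"]) (use x FD in auto)
    then have D2: "(half_line_deriv F has_vector_derivative vec2 (p1 + r1, p1 - r1)) (at x within {0..})"
      by (rule has_vector_derivative_at_within)
    \<comment> \<open>The loop closes here: by the fixed point equation the z inside the sources is
      the rescaled F built from those sources, so they become expressions in u and v.\<close>
    have "z x = (cu + eU x + (cv + eV x), cu + eU x - (cv + eV x))"
      using z[of x] x by (simp add: jost_map_def jost_part_def eU_def eV_def)
    then have zF: "exp (\<mu> * of_real x) * fst (z x) = u x + v x" "exp (\<mu> * of_real x) * snd (z x) = u x - v x"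
      using x by (simp_all add: u v algebra_simps)
    have "exp (\<mu> * of_real x) * ?gu x = (cnj (q x) * (exp (\<mu> * of_real x) * fst (z x)) + q x * (exp (\<mu> * of_real x) * snd (z x))) / 2"
      and "exp (\<mu> * of_real x) * ?gv x = (cnj (q x) * (exp (\<mu> * of_real x) * fst (z x)) - q x * (exp (\<mu> * of_real x) * snd (z x))) / 2"
      using x by (simp_all add: jost_source_def q0_def algebra_simps)
    then have p1: "p1 = - k\<^sup>2 * u x + (cnj (q x) * (u x + v x) + q x * (u x - v x)) / 2"
      and r1: "r1 = k\<^sup>2 * v x + (cnj (q x) * (u x + v x) - q x * (u x - v x)) / 2"
      unfolding p1_def r1_def zF by (simp_all add: power_mult_distrib)
    \<comment> \<open>The product of \<open>eps_mat\<close> and \<open>Q_mat q x\<close> is diagonal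
      with entries \<open>cnj (q x)\<close> and \<open>q x\<close>. Half the sum and half the
      difference of the components of its product with F are the sources of u and v, which explains
      the signs 1 and - 1 in \<open>jost_source\<close>.\<close>
    have "- (eps_mat *v vec2 (p1 + r1, p1 - r1)) + Q_mat q x *v F x = k\<^sup>2 *s F x"
      unfolding p1 r1 F_def
      by (simp add: vec_eq_iff forall_2 matrix_vector_mult_def sum_2 eps_mat_def Q_mat_def vector_2 field_simps)
    then show ?thesis
      using half_line_deriv_eq[OF D2] x differentiableI_vector[OF D2] by simp
  qed
  have "is_solution q k F"
    unfolding is_solution_def
  proof (intro conjI allI impI)
    show "locally_absolutely_continuous_on {0..} F" "locally_absolutely_continuous_on {0..} (half_line_deriv F)"
      by (intro locally_absolutely_continuous_on_half_lineI F_ac H_ac)+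
    show "F differentiable (at x within {0..})" if "0 \<le> x" for x
      using FH[OF that] by (rule differentiableI_vector)
    have "AE x in lebesgue. x \<in> {0<..} \<longrightarrow> half_line_deriv F differentiable (at x within {0..}) \<and>
        - (eps_mat *v half_line_deriv (half_line_deriv F) x) + Q_mat q x *v F x = k\<^sup>2 *s F x"
      using pAE rAE by eventually_elim (use ode in auto)
    then show "AE x in lebesgue_on {0<..}. half_line_deriv F differentiable (at x within {0..}) \<and>
        - (eps_mat *v half_line_deriv (half_line_deriv F) x) + Q_mat q x *v F x = k\<^sup>2 *s F x"
      by (subst AE_restrict_space_iff) simp_all
  qed
  moreover have "small_o_exp \<mu> (\<lambda>x. F x - exp (\<mu> * of_real x) *s vec2 (cu + cv, cu - cv))"
  proof (rule small_o_expI)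
    show "((\<lambda>x. eU x + eV x) \<longlongrightarrow> 0) at_top" "((\<lambda>x. eU x - eV x) \<longlongrightarrow> 0) at_top"
      using tendsto_add[OF tendsto(1,2)] tendsto_diff[OF tendsto(1,2)] by simp_all
    fix x :: real assume "0 \<le> x"
    then show "F x - exp (\<mu> * of_real x) *s vec2 (cu + cv, cu - cv) =
        vec2 (exp (\<mu> * of_real x) * (eU x + eV x), exp (\<mu> * of_real x) * (eU x - eV x))"
      by (simp add: vec_eq_iff forall_2 F_def u v algebra_simps)
  qed
  moreover have "small_o_exp \<mu> (\<lambda>x. half_line_deriv F x - (\<mu> * exp (\<mu> * of_real x)) *s vec2 (cu + cv, cu - cv))"
  proof (rule small_o_expI)
    show "((\<lambda>x. dU x + dV x) \<longlongrightarrow> 0) at_top" "((\<lambda>x. dU x - dV x) \<longlongrightarrow> 0) at_top"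
      using tendsto_add[OF tendsto(3,4)] tendsto_diff[OF tendsto(3,4)] by simp_all
    fix x :: real assume "0 \<le> x"
    then show "half_line_deriv F x - (\<mu> * exp (\<mu> * of_real x)) *s vec2 (cu + cv, cu - cv) =
        vec2 (exp (\<mu> * of_real x) * (dU x + dV x), exp (\<mu> * of_real x) * (dU x - dV x))"
      by (simp add: vec_eq_iff forall_2 FD H_def p r algebra_simps)
  qed
  ultimately show thesis by (rule that)
qed

theorem theorem3p1:
  fixes q :: "real \<Rightarrow> complex" and k :: complex
  assumes "integrable (lebesgue_on {0<..}) q"
    and "k \<noteq> 0"
  shows "\<exists>F_m1 F_p1 F_pi F_mi :: real \<Rightarrow> complex ^ 2.
    is_solution q k F_m1 \<and> is_solution q k F_p1 \<and> is_solution q k F_pi \<and> is_solution q k F_mi \<and>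
    small_o_exp (- k) (\<lambda>x. F_m1 x - exp (- k * of_real x) *s e_minus) \<and>
    small_o_exp k (\<lambda>x. F_p1 x - exp (k * of_real x) *s e_minus) \<and>
    small_o_exp (\<i> * k) (\<lambda>x. F_pi x - exp (\<i> * k * of_real x) *s e_plus) \<and>
    small_o_exp (- \<i> * k) (\<lambda>x. F_mi x - exp (- \<i> * k * of_real x) *s e_plus) \<and>
    small_o_exp (- k) (\<lambda>x. half_line_deriv F_m1 x - (- k * exp (- k * of_real x)) *s e_minus) \<and>
    small_o_exp k (\<lambda>x. half_line_deriv F_p1 x - (k * exp (k * of_real x)) *s e_minus) \<and>
    small_o_exp (\<i> * k) (\<lambda>x. half_line_deriv F_pi x - (\<i> * k * exp (\<i> * k * of_real x)) *s e_plus) \<and>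
    small_o_exp (- \<i> * k) (\<lambda>x. half_line_deriv F_mi x - (- \<i> * k * exp (- \<i> * k * of_real x)) *s e_plus)"
proof -
  \<comment> \<open>The sums are left unevaluated to match \<open>vec2 (cu + cv, cu - cv)\<close>
    with (cu, cv) equal to (0, 1) and (1, 0).\<close>
  have em: "e_minus = vec2 (0 + 1, 0 - 1)" and ep: "e_plus = vec2 (1 + 0, 1 - 0)"
    by (simp_all add: e_minus_def e_plus_def vec2_def)
  \<comment> \<open>The left side parses as \<open>(- \<i>) * k\<close>, while the condition on cu
    is phrased with \<open>- (\<i> * k)\<close>.\<close>
  have mi: "- \<i> * k = - (\<i> * k)" by simp
  note sol = jost_solution[OF assms]
  obtain F_m1 where "is_solution q k F_m1"
    "small_o_exp (- k) (\<lambda>x. F_m1 x - exp (- k * of_real x) *s e_minus)"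
    "small_o_exp (- k) (\<lambda>x. half_line_deriv F_m1 x - (- k * exp (- k * of_real x)) *s e_minus)"
    unfolding em using sol[of 0 "- k" 1] by blast
  moreover obtain F_p1 where "is_solution q k F_p1"
    "small_o_exp k (\<lambda>x. F_p1 x - exp (k * of_real x) *s e_minus)"
    "small_o_exp k (\<lambda>x. half_line_deriv F_p1 x - (k * exp (k * of_real x)) *s e_minus)"
    unfolding em using sol[of 0 k 1] by blast
  moreover obtain F_pi where "is_solution q k F_pi"
    "small_o_exp (\<i> * k) (\<lambda>x. F_pi x - exp (\<i> * k * of_real x) *s e_plus)"
    "small_o_exp (\<i> * k) (\<lambda>x. half_line_deriv F_pi x - (\<i> * k * exp (\<i> * k * of_real x)) *s e_plus)"
    unfolding ep using sol[of 1 "\<i> * k" 0] by blast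
  moreover obtain F_mi where "is_solution q k F_mi"
    "small_o_exp (- \<i> * k) (\<lambda>x. F_mi x - exp (- \<i> * k * of_real x) *s e_plus)"
    "small_o_exp (- \<i> * k) (\<lambda>x. half_line_deriv F_mi x - (- \<i> * k * exp (- \<i> * k * of_real x)) *s e_plus)"
    unfolding ep using sol[of 1 "- \<i> * k" 0, OF disjI2[OF disjI2[OF mi]]] by blast
  ultimately show ?thesis by blast
qed

end
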